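(* There is an absolute constant $c>0$ such that the following holds. Let $n$ be a power of $2$ and let $f:[n]^d\to\{0,1\}$ be $\varepsilon$-far from being monotone. Then $I^-_f\cdot\Gamma^-_f\ge c\,\varepsilon^2$.
   Context: $[n]^d$ is partially ordered coordinatewise; $f$ is monotone if $f(x)\le f(y)$ whenever $x\preceq y$, and $\varepsilon$-far from monotone if it differs from every monotone function on at least an $\varepsilon n^d$ points. The augmented hypergrid $\mathbf{A}_{n,d}$ is the directed graph on $[n]^d$ with an edge $(x,y)$ whenever $x,y$ differ in exactly one coordinate $i$ and $y_i-x_i=2^a$ for some integer $a\ge0$ ($x$ is the lower endpoint). $S^-_f$ is the set of edges $(x,y)$ of $\mathbf{A}_{n,d}$ with $f(x)=1$ and $f(y)=0$. $I^-_f:=|S^-_f|/n^d$, and $\Gamma^-_f:=\frac{1}{n^d}\cdot$ (size of a maximum-cardinality matching contained in $S^-_f$). *)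

theory Defs
  imports Complex_Main "HOL-Library.FuncSet"
begin

text \<open>
  Points of $[n]^d$ are extensional functions on the index set \<open>{..<d}\<close>. Since they all take the same
  value outside \<open>{..<d}\<close>, the library order on functions restricts to the coordinatewise order
  on the grid, and \<open>mono_on (grid n d)\<close> is monotonicity on $[n]^d$.
\<close>

definition grid :: "nat \<Rightarrow> nat \<Rightarrow> (nat \<Rightarrow> nat) set" where
  "grid n d = {..<d} \<rightarrow>\<^sub>E {1..n}"

lemma grid_le_iff:
  assumes "x \<in> grid n d" and "y \<in> grid n d"
  shows "x \<le> y \<longleftrightarrow> (\<forall>i<d. x i \<le> y i)"
  using assms unfolding grid_def le_fun_def
  by (metis PiE_arb lessThan_iff order_refl)

definition far_from_monotone :: "nat \<Rightarrow> nat \<Rightarrow> real \<Rightarrow> ((nat \<Rightarrow> nat) \<Rightarrow> nat) \<Rightarrow> bool" where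
  "far_from_monotone n d \<epsilon> f \<longleftrightarrow>
     (\<forall>g \<in> grid n d \<rightarrow> {0, 1}. mono_on (grid n d) g \<longrightarrow>
        real (card {x \<in> grid n d. f x \<noteq> g x}) \<ge> \<epsilon> * real (n ^ d))"

definition aug_edges :: "nat \<Rightarrow> nat \<Rightarrow> ((nat \<Rightarrow> nat) \<times> (nat \<Rightarrow> nat)) set" where
  "aug_edges n d = {(x, y). x \<in> grid n d \<and> y \<in> grid n d \<and>
     (\<exists>i<d. (\<exists>a::nat. y i = x i + 2 ^ a) \<and> (\<forall>j<d. j \<noteq> i \<longrightarrow> y j = x j))}"

definition violated_edges ::
    "nat \<Rightarrow> nat \<Rightarrow> ((nat \<Rightarrow> nat) \<Rightarrow> nat) \<Rightarrow> ((nat \<Rightarrow> nat) \<times> (nat \<Rightarrow> nat)) set" where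
  "violated_edges n d f = {(x, y) \<in> aug_edges n d. f x = 1 \<and> f y = 0}"

definition is_matching :: "('a \<times> 'a) set \<Rightarrow> bool" where
  "is_matching M \<longleftrightarrow>
     (\<forall>e\<in>M. \<forall>e'\<in>M. e \<noteq> e' \<longrightarrow> {fst e, snd e} \<inter> {fst e', snd e'} = {})"

definition neg_influence :: "nat \<Rightarrow> nat \<Rightarrow> ((nat \<Rightarrow> nat) \<Rightarrow> nat) \<Rightarrow> real" where
  "neg_influence n d f = real (card (violated_edges n d f)) / real (n ^ d)"

definition neg_matching :: "nat \<Rightarrow> nat \<Rightarrow> ((nat \<Rightarrow> nat) \<Rightarrow> nat) \<Rightarrow> real" where
  "neg_matching n d f =
     real (Max {card M |M. M \<subseteq> violated_edges n d f \<and> is_matching M}) / real (n ^ d)"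

lemma finite_grid: "finite (grid n d)"
  by (simp add: grid_def finite_PiE)

lemma finite_violated_edges: "finite (violated_edges n d f)"
  by (rule finite_subset[of _ "grid n d \<times> grid n d"])
     (auto simp: violated_edges_def aug_edges_def finite_grid)

text \<open>The maximum in \<^const>\<open>neg_matching\<close> is over a finite nonempty set.\<close>

lemma matching_sizes:
  shows "finite {card M |M. M \<subseteq> violated_edges n d f \<and> is_matching M}"
    and "{card M |M. M \<subseteq> violated_edges n d f \<and> is_matching M} \<noteq> {}"
proof -
  have "{card M |M. M \<subseteq> violated_edges n d f \<and> is_matching M}
          \<subseteq> card ` Pow (violated_edges n d f)"
    by auto
  then show "finite {card M |M. M \<subseteq> violated_edges n d f \<and> is_matching M}"
    by (rule finite_subset) (simp add: finite_violated_edges)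
  have "is_matching ({} :: ((nat \<Rightarrow> nat) \<times> (nat \<Rightarrow> nat)) set)"
    by (simp add: is_matching_def)
  then show "{card M |M. M \<subseteq> violated_edges n d f \<and> is_matching M} \<noteq> {}"
    by blast
qed

end

theory Submission imports Defs "HOL-Library.Disjoint_Sets" begin

text \<open>
  Let $F$ be the set of ones of $f$, let $N$ be the number of violated edges and $\nu$ the size of a maximum
  matching among them. Sorting $F$ along one coordinate after the other gives an upward closed set $G$.
  On a line, sorting the even and the odd positions first leaves an alternating block to be sorted, and this
  moves the ones upwards along at most twice as many edges as are violated; hence all of $F$ moves to $G$ along
  at most $2N$ edges in total.

  Conversely, take $R + 1$ copies of the grid as layers, with an edge of the augmented hypergrid, or no
  move at all, between consecutive layers. Since translations commute, Pluennecke's argument shows that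
  a minimum vertex cut between sources and targets joined by a system of such paths can be pushed into the two
  outer layers, so a cut is at least as large as the number of sources. The end points of a maximum matching
  meet every violated edge, so they yield a cut and
  $|F \setminus G| \le 2 (R + 1) \nu + 2 N / (R + 1)$ for all $R$. The best choice is
  $R \approx 4 N / |F \setminus G|$.
\<close>

section \<open>Minimum cuts in layered commutative graphs\<close>

text \<open>The paths that carry \<open>F\<close> to \<open>G\<close> may overlap heavily, so the
  violated edges on which they leave \<open>F\<close> do not form a matching. A cut is insensitive
  to overlaps, since it has to meet every path from a source to a target under any pairing. In a
  general layered graph a cut can still be tiny, because all paths may squeeze through one inner
  vertex; commutativity excludes such a bottleneck, as two consecutive steps can be taken in the
  other order. The price of layering is that a vertex of the cover must be blocked at each time
  separately, which is the factor \<open>R + 1\<close>, and that paths must have a common length,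
  which is why standing still is allowed.

  On the other side, sorting one direction might create violations in another and spoil the bound
  \<open>2 * N\<close>. It does not: on parallel lines, sorted sets are nested, and nested sets of
  given sizes have the smallest possible difference. So every direction is charged only for the
  violations that it had in \<open>F\<close>.\<close>

lemma hall_marriage:
  fixes N :: "'a \<Rightarrow> 'b set"
  assumes "finite A" and "\<And>x. x \<in> A \<Longrightarrow> finite (N x)"
    and "\<And>X. X \<subseteq> A \<Longrightarrow> card X \<le> card (\<Union>(N ` X))"
  shows "\<exists>r. inj_on r A \<and> (\<forall>x\<in>A. r x \<in> N x)"
  using assms
proof (induction "card A" arbitrary: A N rule: less_induct)
  case less
  note fin = less.prems(1) and finN = less.prems(2) and hall = less.prems(3)
  show ?case
  proof (cases "A = {}")
    case False
    then obtain a where a: "a \<in> A" by blast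
    \<comment> \<open>Halmos-Vaughan induction. A nonempty proper subset \<open>X\<close> that
      exactly fills its neighbourhood \<open>U\<close> is matched into \<open>U\<close>; the other
      points keep Hall's condition after deletion of \<open>U\<close>, because
      \<open>card U = card X\<close>.\<close>
    show ?thesis
    proof (cases "\<exists>X. X \<subset> A \<and> X \<noteq> {} \<and> card (\<Union>(N ` X)) = card X")
      case True
      then obtain X where X: "X \<subset> A" "X \<noteq> {}" "card (\<Union>(N ` X)) = card X" by blast
      define U where "U = \<Union>(N ` X)"
      have finX: "finite X" using X(1) fin finite_subset by blast
      have finU: "finite U" unfolding U_def using finX finN X(1) by auto
      have "card X < card A" using X(1) fin psubset_card_mono by blast
      then have "\<exists>r. inj_on r X \<and> (\<forall>x\<in>X. r x \<in> N x)"
      proof (rule less.hyps[OF _ finX])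
        show "finite (N x)" if "x \<in> X" for x using finN that X(1) by blast
        show "card Y \<le> card (\<Union>(N ` Y))" if "Y \<subseteq> X" for Y using hall that X(1) by blast
      qed
      then obtain r where r: "inj_on r X" "\<And>x. x \<in> X \<Longrightarrow> r x \<in> N x" by blast
      have "card (A - X) < card A"
        using X fin by (intro psubset_card_mono) auto
      moreover have "card Y \<le> card (\<Union>((\<lambda>x. N x - U) ` Y))" if Y: "Y \<subseteq> A - X" for Y
      proof -
        have finY: "finite Y" using Y fin finite_subset by blast
        have eq: "\<Union>(N ` (X \<union> Y)) = U \<union> \<Union>((\<lambda>x. N x - U) ` Y)"
          unfolding U_def by auto
        have "card X + card Y = card (X \<union> Y)"
          using Y finX finY by (subst card_Un_disjoint) auto
        also have "\<dots> \<le> card (\<Union>(N ` (X \<union> Y)))"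
          using Y X by (intro hall) auto
        also have "\<dots> \<le> card U + card (\<Union>((\<lambda>x. N x - U) ` Y))"
          unfolding eq by (rule card_Un_le)
        finally show ?thesis using X(3) U_def by simp
      qed
      ultimately have "\<exists>q. inj_on q (A - X) \<and> (\<forall>x\<in>A - X. q x \<in> N x - U)"
        using less.hyps[of "A - X" "\<lambda>x. N x - U"] fin finN by auto
      then obtain q where q: "inj_on q (A - X)" "\<And>x. x \<in> A - X \<Longrightarrow> q x \<in> N x - U" by blast
      define h where "h x = (if x \<in> X then r x else q x)" for x
      have "inj_on h A"
      proof -
        have "inj_on h X" using r(1) by (rule inj_on_cong[THEN iffD1, rotated]) (simp add: h_def)
        moreover have "inj_on h (A - X)"
          using q(1) by (rule inj_on_cong[THEN iffD1, rotated]) (simp add: h_def)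
        moreover have "h ` X \<subseteq> U" using r(2) by (auto simp: h_def U_def)
        moreover have "h ` (A - X) \<inter> U = {}" using q(2) by (auto simp: h_def)
        moreover have "X \<union> (A - X) = A" using X(1) by blast
        moreover have "(X - (A - X)) = X" "(A - X) - X = A - X" by blast+
        ultimately show ?thesis using inj_on_Un[of h X "A - X"] by auto
      qed
      moreover have "\<forall>x\<in>A. h x \<in> N x" using r(2) q(2) by (auto simp: h_def)
      ultimately show ?thesis by blast
    next
      \<comment> \<open>Now every nonempty proper subset has a neighbour to spare, so any value
        \<open>b\<close> may be given to \<open>a\<close>.\<close>
      case False
      have "card {a} \<le> card (\<Union>(N ` {a}))" by (rule hall) (use a in auto)
      then obtain b where b: "b \<in> N a" by fastforce
      have "card Y \<le> card (\<Union>((\<lambda>x. N x - {b}) ` Y))" if Y: "Y \<subseteq> A - {a}" for Y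
      proof (cases "Y = {}")
        case False2: False
        have "Y \<subset> A" using Y a by blast
        then have "card Y \<noteq> card (\<Union>(N ` Y))" using False False2 by metis
        moreover have "card Y \<le> card (\<Union>(N ` Y))" using Y by (intro hall) auto
        ultimately have lt: "card Y < card (\<Union>(N ` Y))" by simp
        have "\<Union>((\<lambda>x. N x - {b}) ` Y) = \<Union>(N ` Y) - {b}" by auto
        moreover have "card (\<Union>(N ` Y)) - 1 \<le> card (\<Union>(N ` Y) - {b})"
          by (simp add: card_Diff_singleton_if)
        ultimately show ?thesis using lt by simp
      qed simp
      moreover have "card (A - {a}) < card A" using a fin by (meson card_Diff1_less)
      ultimately have "\<exists>q. inj_on q (A - {a}) \<and> (\<forall>x\<in>A - {a}. q x \<in> N x - {b})"
        using less.hyps[of "A - {a}" "\<lambda>x. N x - {b}"] fin finN by auto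
      then obtain q where q: "inj_on q (A - {a})" "\<And>x. x \<in> A - {a} \<Longrightarrow> q x \<in> N x - {b}" by blast
      have "inj_on (q(a := b)) A"
        using q a by (auto simp: inj_on_def fun_upd_def)
      moreover have "\<forall>x\<in>A. (q(a := b)) x \<in> N x" using q(2) b by auto
      ultimately show ?thesis by blast
    qed
  qed simp
qed

lemma sum_card_swap:
  assumes "finite A" "finite B"
  shows "(\<Sum>s\<in>A. card {u\<in>B. P u s}) = (\<Sum>u\<in>B. card {s\<in>A. P u s})"
proof -
  have "(\<Sum>s\<in>A. card {u\<in>B. P u s}) = (\<Sum>s\<in>A. \<Sum>u\<in>B. if P u s then 1 else 0)"
    using assms by (simp add: sum.If_cases Int_def conj_commute)
  also have "\<dots> = (\<Sum>u\<in>B. \<Sum>s\<in>A. if P u s then 1 else 0)" by (rule sum.swap)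
  also have "\<dots> = (\<Sum>u\<in>B. card {s\<in>A. P u s})"
    using assms by (simp add: sum.If_cases Int_def conj_commute)
  finally show ?thesis .
qed

text \<open>\<open>c u v w\<close> is the other middle vertex of the two-step path from
  \<open>u\<close> over \<open>v\<close> to \<open>w\<close>. The injectivity axioms embed the
  out-neighbours of \<open>v\<close> into those of \<open>u\<close>, and the in-neighbours of
  \<open>v\<close> into those of \<open>w\<close>.\<close>

locale commutative_graph =
  fixes E :: "('v \<times> 'v) set" and c :: "'v \<Rightarrow> 'v \<Rightarrow> 'v \<Rightarrow> 'v"
  assumes finite_edges: "finite E"
    and flip: "(u, v) \<in> E \<Longrightarrow> (v, w) \<in> E \<Longrightarrow> (u, c u v w) \<in> E \<and> (c u v w, w) \<in> E"
    and flip_inj_head: "(u, v) \<in> E \<Longrightarrow> (v, w) \<in> E \<Longrightarrow> (v, w') \<in> E \<Longrightarrow> c u v w = c u v w' \<Longrightarrow> w = w'"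
    and flip_inj_tail: "(u, v) \<in> E \<Longrightarrow> (u', v) \<in> E \<Longrightarrow> (v, w) \<in> E \<Longrightarrow> c u v w = c u' v w \<Longrightarrow> u = u'"
begin

definition path_on :: "nat \<Rightarrow> nat \<Rightarrow> (nat \<Rightarrow> 'v) \<Rightarrow> bool" where
  "path_on l m p \<longleftrightarrow> (\<forall>i. l \<le> i \<and> i < m \<longrightarrow> (p i, p (Suc i)) \<in> E)"

text \<open>The layered graph is not built: an element of \<open>K\<close> is a time together with a
  vertex, and it blocks the paths that visit the vertex at that time.\<close>

definition layered_cut :: "nat \<Rightarrow> 'v set \<Rightarrow> 'v set \<Rightarrow> (nat \<times> 'v) set \<Rightarrow> bool" where
  "layered_cut R S T K \<longleftrightarrow>
     (\<forall>p. p 0 \<in> S \<longrightarrow> p R \<in> T \<longrightarrow> path_on 0 R p \<longrightarrow> (\<exists>i\<le>R. (i, p i) \<in> K))"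

definition reach :: "'v set \<Rightarrow> (nat \<times> 'v) set \<Rightarrow> nat \<Rightarrow> 'v \<Rightarrow> bool" where
  "reach S K l u \<longleftrightarrow> (\<exists>p. p 0 \<in> S \<and> p l = u \<and> path_on 0 l p \<and> (\<forall>i\<le>l. (i, p i) \<notin> K))"

definition coreach :: "nat \<Rightarrow> 'v set \<Rightarrow> (nat \<times> 'v) set \<Rightarrow> nat \<Rightarrow> 'v \<Rightarrow> bool" where
  "coreach R T K m w \<longleftrightarrow>
     (\<exists>p. p m = w \<and> p R \<in> T \<and> path_on m R p \<and> (\<forall>i. m \<le> i \<and> i \<le> R \<longrightarrow> (i, p i) \<notin> K))"

text \<open>Two half paths that avoid \<open>K\<close> are spliced at \<open>v\<close>; layer
  \<open>Suc l\<close> is the only place left where \<open>K\<close> can meet the result.\<close>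

lemma middle_in_cut:
  assumes cut: "layered_cut R S T K" and u: "reach S K l u" and w: "coreach R T K (Suc (Suc l)) w"
    and uv: "(u, v) \<in> E" and vw: "(v, w) \<in> E" and l: "Suc (Suc l) \<le> R"
  shows "(Suc l, v) \<in> K"
proof -
  obtain p where p: "p 0 \<in> S" "p l = u" "path_on 0 l p" "\<forall>i\<le>l. (i, p i) \<notin> K"
    using u unfolding reach_def by blast
  obtain q where q: "q (Suc (Suc l)) = w" "q R \<in> T" "path_on (Suc (Suc l)) R q"
      "\<forall>i. Suc (Suc l) \<le> i \<and> i \<le> R \<longrightarrow> (i, q i) \<notin> K"
    using w unfolding coreach_def by blast
  define s where "s i = (if i \<le> l then p i else if i = Suc l then v else q i)" for i
  have "path_on 0 R s"
    unfolding path_on_def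
  proof (intro allI impI, elim conjE)
    fix i assume "i < R"
    consider "i < l" | "i = l" | "i = Suc l" | "i \<ge> Suc (Suc l)" by linarith
    then show "(s i, s (Suc i)) \<in> E"
      using p q uv vw \<open>i < R\<close> by cases (auto simp: s_def path_on_def)
  qed
  moreover have "s 0 \<in> S" "s R \<in> T" using p q l by (auto simp: s_def)
  ultimately obtain i where "i \<le> R" "(i, s i) \<in> K" using cut unfolding layered_cut_def by blast
  moreover have "i = Suc l"
    using calculation p(4) q(4) by (auto simp: s_def split: if_splits)
  ultimately show ?thesis by (auto simp: s_def)
qed

text \<open>If the first meeting of a path with \<open>K\<close> is in the removed part, the vertex
  one layer before it has been reached outside \<open>K\<close> and is therefore one of the added
  vertices.\<close>

lemma cut_replace_down:
  assumes cut: "layered_cut R S T K" and l: "Suc l \<le> R"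
  shows "layered_cut R S T (K - {Suc l} \<times> X \<union> {l} \<times> {u. reach S K l u \<and> (\<exists>s\<in>X. (u, s) \<in> E)})"
  unfolding layered_cut_def
proof (intro allI impI)
  fix p assume p: "p 0 \<in> S" "p R \<in> T" "path_on 0 R p"
  define i where "i = (LEAST i. i \<le> R \<and> (i, p i) \<in> K)"
  have i: "i \<le> R" "(i, p i) \<in> K"
    using LeastI_ex[of "\<lambda>i. i \<le> R \<and> (i, p i) \<in> K"] cut p unfolding layered_cut_def i_def by auto
  have before: "(i', p i') \<notin> K" if "i' < i" for i'
    using not_less_Least[of i' "\<lambda>i. i \<le> R \<and> (i, p i) \<in> K"] that i(1) unfolding i_def by auto
  show "\<exists>i\<le>R. (i, p i) \<in> K - {Suc l} \<times> X \<union> {l} \<times> {u. reach S K l u \<and> (\<exists>s\<in>X. (u, s) \<in> E)}"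
  proof (cases "i = Suc l \<and> p i \<in> X")
    case True
    have "reach S K l (p l)"
      unfolding reach_def using p before True l by (intro exI[of _ p]) (auto simp: path_on_def)
    moreover have "(p l, p (Suc l)) \<in> E" using p(3) l by (auto simp: path_on_def)
    ultimately show ?thesis using True l by (intro exI[of _ l]) auto
  next
    case False
    then show ?thesis using i by (intro exI[of _ i]) auto
  qed
qed

text \<open>Mirror image of \<open>cut_replace_down\<close>, with the last meeting in place of the
  first.\<close>

lemma cut_replace_up:
  assumes cut: "layered_cut R S T K" and l: "Suc l \<le> R"
  shows "layered_cut R S T (K - {l} \<times> X \<union> {Suc l} \<times> {w. coreach R T K (Suc l) w \<and> (\<exists>s\<in>X. (s, w) \<in> E)})"
  unfolding layered_cut_def
proof (intro allI impI)
  fix p assume p: "p 0 \<in> S" "p R \<in> T" "path_on 0 R p"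
  define i where "i = Max {i. i \<le> R \<and> (i, p i) \<in> K}"
  have fin: "finite {i. i \<le> R \<and> (i, p i) \<in> K}" by simp
  have "{i. i \<le> R \<and> (i, p i) \<in> K} \<noteq> {}" using cut p unfolding layered_cut_def by blast
  then have i: "i \<le> R" "(i, p i) \<in> K" using Max_in[OF fin] unfolding i_def by auto
  have after: "(i', p i') \<notin> K" if "i < i'" "i' \<le> R" for i'
    using Max_ge[OF fin] that unfolding i_def by (metis (mono_tags, lifting) mem_Collect_eq not_le)
  show "\<exists>i\<le>R. (i, p i) \<in> K - {l} \<times> X \<union> {Suc l} \<times> {w. coreach R T K (Suc l) w \<and> (\<exists>s\<in>X. (s, w) \<in> E)}"
  proof (cases "i = l \<and> p i \<in> X")
    case True
    have "coreach R T K (Suc l) (p (Suc l))"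
      unfolding coreach_def using p after True l by (intro exI[of _ p]) (auto simp: path_on_def)
    moreover have "(p l, p (Suc l)) \<in> E" using p(3) l by (auto simp: path_on_def)
    ultimately show ?thesis using True l by (intro exI[of _ "Suc l"]) auto
  next
    case False
    then show ?thesis using i by (intro exI[of _ i]) auto
  qed
qed

lemma card_replace_layer:
  fixes K :: "(nat \<times> 'v) set"
  assumes "finite K" "finite N" "{l} \<times> X \<subseteq> K"
  shows "card (K - {l} \<times> X \<union> {m} \<times> N) + card X \<le> card K + card N"
proof -
  have fX: "finite ({l} \<times> X)" using assms finite_subset by blast
  have "card (K - {l} \<times> X \<union> {m} \<times> N) \<le> card (K - {l} \<times> X) + card ({m} \<times> N)" by (rule card_Un_le)
  also have "card (K - {l} \<times> X) = card K - card ({l} \<times> X)" using fX assms(3) by (rule card_Diff_subset)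
  finally show ?thesis
    using card_mono[OF assms(1,3)] by (simp add: card_cartesian_product)
qed

lemma finite_heads: "finite {w. Q w \<and> (\<exists>s\<in>X. (s, w) \<in> E)}"
  by (rule finite_subset[OF _ finite_imageI[OF finite_edges, of snd]]) force

lemma finite_tails: "finite {u. Q u \<and> (\<exists>s\<in>X. (u, s) \<in> E)}"
  by (rule finite_subset[OF _ finite_imageI[OF finite_edges, of fst]]) force

text \<open>
  The argument behind Pluennecke's inequality: if an inner layer of the cut had a vertex, then minimality
  would provide more predecessors than the layer has vertices, while commutativity makes in-degrees grow
  and out-degrees shrink along edges.
\<close>

lemma minimum_cut_outer:
  assumes cut: "layered_cut R S T K" and fin: "finite K"
    and min: "\<And>K'. finite K' \<Longrightarrow> layered_cut R S T K' \<Longrightarrow> card K \<le> card K'"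
    and low: "\<And>K'. finite K' \<Longrightarrow> layered_cut R S T K' \<Longrightarrow> card K' = card K \<Longrightarrow> sum fst K \<le> sum fst K'"
    and mem: "(j, s) \<in> K"
  shows "j = 0 \<or> R \<le> j"
proof (rule ccontr)
  assume "\<not> (j = 0 \<or> R \<le> j)"
  then obtain l where jl: "j = Suc l" and l: "Suc (Suc l) \<le> R"
    by (metis Suc_leI not0_implies_Suc not_le)
  define L where "L = {s. (Suc l, s) \<in> K}"
  have finL: "finite L"
    by (rule finite_subset[OF _ finite_imageI[OF fin, of snd]]) (force simp: L_def)
  have LK: "{Suc l} \<times> X \<subseteq> K" if "X \<subseteq> L" for X using that by (auto simp: L_def)
  define U where "U X = {u. reach S K l u \<and> (\<exists>s\<in>X. (u, s) \<in> E)}" for X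
  define W where "W X = {w. coreach R T K (Suc (Suc l)) w \<and> (\<exists>s\<in>X. (s, w) \<in> E)}" for X
  have finU: "finite (U X)" and finW: "finite (W X)" for X
    unfolding U_def W_def by (rule finite_tails, rule finite_heads)
  have cutU: "layered_cut R S T (K - {Suc l} \<times> X \<union> {l} \<times> U X)" for X
    unfolding U_def by (rule cut_replace_down[OF cut]) (use l in simp)
  have cutW: "layered_cut R S T (K - {Suc l} \<times> X \<union> {Suc (Suc l)} \<times> W X)" for X
    unfolding W_def by (rule cut_replace_up[OF cut l])
  have hallU: "card X \<le> card (U X)" if "X \<subseteq> L" for X
    using card_replace_layer[OF fin finU LK[OF that], of l X] min[OF _ cutU[of X]] fin finU
    by auto
  have hallW: "card X \<le> card (W X)" if "X \<subseteq> L" for X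
    using card_replace_layer[OF fin finW LK[OF that], of "Suc (Suc l)" X] min[OF _ cutW[of X]] fin finW
    by auto
  \<comment> \<open>With equality, replacing the layer by \<open>U L\<close> would give another
    minimum cut with a smaller sum of layer numbers, against \<open>low\<close>.\<close>
  have more: "card L < card (U L)"
  proof (rule ccontr)
    assume "\<not> card L < card (U L)"
    then have eq: "card (U L) = card L" using hallU[of L] by simp
    define K' where "K' = K - {Suc l} \<times> L \<union> {l} \<times> U L"
    have finK': "finite K'" using fin finU by (auto simp: K'_def)
    have cutK': "layered_cut R S T K'" unfolding K'_def by (rule cutU)
    have "card K' = card K"
      using card_replace_layer[OF fin finU LK[OF subset_refl], of l L] eq min[OF finK' cutK']
      by (simp add: K'_def)
    then have "sum fst K \<le> sum fst K'" by (rule low[OF finK' cutK'])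
    also have "sum fst K' \<le> sum fst (K - {Suc l} \<times> L) + sum fst ({l} \<times> U L)"
      unfolding K'_def using fin finU by (intro sum_Un_nat[THEN eq_refl, THEN order_trans]) auto
    also have "sum fst ({l} \<times> U L) = l * card (U L)"
      by (simp add: sum.cartesian_product' card_cartesian_product)
    also have "l * card (U L) = l * card L" using eq by simp
    finally have "sum fst K \<le> sum fst (K - {Suc l} \<times> L) + l * card L" .
    moreover have "sum fst K = sum fst (K - {Suc l} \<times> L) + sum fst ({Suc l} \<times> L)"
      using sum.subset_diff[OF LK[OF subset_refl] fin, of fst] .
    moreover have "sum fst ({Suc l} \<times> L) = Suc l * card L"
      by (simp add: sum.cartesian_product')
    moreover have "card L > 0" using mem jl finL by (auto simp: L_def card_gt_0_iff)
    ultimately show False by simp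
  qed
  \<comment> \<open>Replacing any part of the layer cannot shrink a minimum cut. This is Hall's
    condition, both downwards (\<open>r\<close>) and upwards (\<open>t\<close>).\<close>
  have "\<exists>r. inj_on r L \<and> (\<forall>x\<in>L. r x \<in> U {x})"
  proof (rule hall_marriage[OF finL finU])
    fix X assume "X \<subseteq> L"
    moreover have "\<Union>((\<lambda>x. U {x}) ` X) = U X" by (auto simp: U_def)
    ultimately show "card X \<le> card (\<Union>((\<lambda>x. U {x}) ` X))" using hallU by simp
  qed
  then obtain r where r: "inj_on r L" "\<And>x. x \<in> L \<Longrightarrow> r x \<in> U {x}" by blast
  have "\<exists>t. inj_on t L \<and> (\<forall>x\<in>L. t x \<in> W {x})"
  proof (rule hall_marriage[OF finL finW])
    fix X assume "X \<subseteq> L"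
    moreover have "\<Union>((\<lambda>x. W {x}) ` X) = W X" by (auto simp: W_def)
    ultimately show "card X \<le> card (\<Union>((\<lambda>x. W {x}) ` X))" using hallW by simp
  qed
  then obtain t where t: "inj_on t L" "\<And>x. x \<in> L \<Longrightarrow> t x \<in> W {x}" by blast
  have mid: "v \<in> L" if "u \<in> U L" "w \<in> W L" "(u, v) \<in> E" "(v, w) \<in> E" for u v w
    using middle_in_cut[OF cut _ _ that(3,4) l] that(1,2) by (auto simp: U_def W_def L_def)
  have rU: "r x \<in> U L" "(r x, x) \<in> E" and tW: "t x \<in> W L" "(x, t x) \<in> E" if "x \<in> L" for x
    using r(2)[OF that] t(2)[OF that] that by (auto simp: U_def W_def)
  \<comment> \<open>The edges between \<open>U L\<close> and \<open>L\<close> are counted in a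
    circle. Flipping along the edge from \<open>x\<close> to \<open>t x\<close> turns in-edges of
    \<open>x\<close> into in-edges of \<open>t x\<close>; flipping along the edge from
    \<open>r x\<close> to \<open>x\<close> turns out-edges of \<open>x\<close> into out-edges of
    \<open>r x\<close>. By \<open>mid\<close> the new middle vertices stay in \<open>L\<close>. The
    circle contains a strict step, since by \<open>more\<close> some vertex of \<open>U L\<close> is
    not a value of \<open>r\<close>.\<close>
  have "(\<Sum>x\<in>L. card {u \<in> U L. (u, x) \<in> E}) \<le> (\<Sum>x\<in>L. card {y \<in> L. (y, t x) \<in> E})"
  proof (rule sum_mono)
    fix x assume x: "x \<in> L"
    show "card {u \<in> U L. (u, x) \<in> E} \<le> card {y \<in> L. (y, t x) \<in> E}"
    proof (rule card_inj_on_le[of "\<lambda>u. c u x (t x)"])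
      show "inj_on (\<lambda>u. c u x (t x)) {u \<in> U L. (u, x) \<in> E}"
        using flip_inj_tail tW(2)[OF x] by (auto intro!: inj_onI)
      show "(\<lambda>u. c u x (t x)) ` {u \<in> U L. (u, x) \<in> E} \<subseteq> {y \<in> L. (y, t x) \<in> E}"
        using flip tW[OF x] mid by blast
    qed (use finL in simp)
  qed
  also have "\<dots> = (\<Sum>w\<in>t ` L. card {y \<in> L. (y, w) \<in> E})"
    by (simp add: sum.reindex[OF t(1)])
  also have "\<dots> = (\<Sum>x\<in>L. card {w \<in> t ` L. (x, w) \<in> E})"
    using sum_card_swap[of "t ` L" L "\<lambda>y w. (y, w) \<in> E"] finL by simp
  also have "\<dots> \<le> (\<Sum>x\<in>L. card {y \<in> L. (r x, y) \<in> E})"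
  proof (rule sum_mono)
    fix x assume x: "x \<in> L"
    show "card {w \<in> t ` L. (x, w) \<in> E} \<le> card {y \<in> L. (r x, y) \<in> E}"
    proof (rule card_inj_on_le[of "\<lambda>w. c (r x) x w"])
      show "inj_on (\<lambda>w. c (r x) x w) {w \<in> t ` L. (x, w) \<in> E}"
        using flip_inj_head rU(2)[OF x] by (auto intro!: inj_onI)
      show "(\<lambda>w. c (r x) x w) ` {w \<in> t ` L. (x, w) \<in> E} \<subseteq> {y \<in> L. (r x, y) \<in> E}"
        using flip rU[OF x] mid tW(1) by blast
    qed (use finL in simp)
  qed
  also have "\<dots> = (\<Sum>u\<in>r ` L. card {y \<in> L. (u, y) \<in> E})"
    by (simp add: sum.reindex[OF r(1)])
  also have "\<dots> < (\<Sum>u\<in>U L. card {y \<in> L. (u, y) \<in> E})"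
  proof -
    have "r ` L \<noteq> U L" using more card_image[OF r(1)] by force
    then obtain b where b: "b \<in> U L" "b \<notin> r ` L" using rU(1) by blast
    then have "0 < card {y \<in> L. (b, y) \<in> E}"
      using finL by (auto simp: card_gt_0_iff U_def)
    then show ?thesis using b rU(1) finU by (intro sum_strict_mono2[of _ _ b]) auto
  qed
  also have "\<dots> = (\<Sum>x\<in>L. card {u \<in> U L. (u, x) \<in> E})"
    using sum_card_swap[OF finL finU, of L "\<lambda>u x. (u, x) \<in> E"] by simp
  finally show False by simp
qed

text \<open>Among the minimum cuts, one with the least sum of layer numbers has vertices in outer
  layers only. It can meet the path from \<open>x\<close> to \<open>\<mu> x\<close> only at an end
  point, and no two sources share such an end point.\<close>

lemma card_sources_le_cut:
  assumes inj: "inj_on \<mu> S"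
    and paths: "\<And>x. x \<in> S \<Longrightarrow> \<exists>p. p 0 = x \<and> p R = \<mu> x \<and> path_on 0 R p"
    and cut: "layered_cut R S (\<mu> ` S) K" and fin: "finite K"
  shows "card S \<le> card K"
proof -
  define P where "P K' \<longleftrightarrow> finite K' \<and> layered_cut R S (\<mu> ` S) K'" for K'
  have "P K" using cut fin by (simp add: P_def)
  then obtain K1 where K1: "P K1" "\<And>K'. P K' \<Longrightarrow> card K1 \<le> card K'"
    using ex_has_least_nat[of P K card] by blast
  then obtain K2 where K2: "P K2" "card K2 = card K1"
      "\<And>K'. P K' \<Longrightarrow> card K' = card K1 \<Longrightarrow> sum fst K2 \<le> sum fst K'"
    using ex_has_least_nat[of "\<lambda>K'. P K' \<and> card K' = card K1" K1 "sum fst"] by blast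
  have outer: "i = 0 \<or> R \<le> i" if "(i, s) \<in> K2" for i s
    using minimum_cut_outer[of R S "\<mu> ` S" K2 i s] K1 K2 that by (auto simp: P_def)
  have hit: "(0, x) \<in> K2 \<or> (R, \<mu> x) \<in> K2" if x: "x \<in> S" for x
  proof -
    obtain p where p: "p 0 = x" "p R = \<mu> x" "path_on 0 R p" using paths[OF x] by blast
    then obtain i where "i \<le> R" "(i, p i) \<in> K2"
      using K2(1) x unfolding P_def layered_cut_def by blast
    then show ?thesis using outer[of i "p i"] p by auto
  qed
  \<comment> \<open>For \<open>R = 0\<close> the two outer layers coincide, and injectivity needs
    this extra fact.\<close>
  have R0: "\<mu> x = x" if "x \<in> S" "R = 0" for x using paths[OF that(1)] that(2) by auto
  have "card S \<le> card K2"
  proof (rule card_inj_on_le[of "\<lambda>x. if (0, x) \<in> K2 then (0, x) else (R, \<mu> x)"])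
    show "inj_on (\<lambda>x. if (0, x) \<in> K2 then (0, x) else (R, \<mu> x)) S"
      using inj R0 hit by (auto intro!: inj_onI split: if_splits dest: inj_onD)
    show "(\<lambda>x. if (0, x) \<in> K2 then (0, x) else (R, \<mu> x)) ` S \<subseteq> K2" using hit by auto
    show "finite K2" using K2(1) by (simp add: P_def)
  qed
  also have "\<dots> \<le> card K" using K1(2)[OF \<open>P K\<close>] K2(2) by simp
  finally show ?thesis .
qed

end

section \<open>Sorting a line\<close>

text \<open>The paths of different points may share vertices and edges; only the sum of their
  lengths is bounded.\<close>

definition transport :: "('a \<times> 'a) set \<Rightarrow> 'a set \<Rightarrow> 'a set \<Rightarrow> nat \<Rightarrow> bool" where
  "transport E A B m \<longleftrightarrow> (\<exists>\<pi> len. bij_betw \<pi> A B \<and> (\<forall>x\<in>A. (x, \<pi> x) \<in> E ^^ len x) \<and> sum len A \<le> m)"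

lemma transport_refl: "transport E A A m"
  unfolding transport_def by (intro exI[of _ id] exI[of _ "\<lambda>_. 0"]) auto

lemma transport_mono: "transport E A B m \<Longrightarrow> m \<le> m' \<Longrightarrow> transport E A B m'"
  unfolding transport_def by (meson order_trans)

lemma transport_trans:
  assumes "transport E A B m" and "transport E B C m'"
  shows "transport E A C (m + m')"
proof -
  obtain \<pi> len where 1: "bij_betw \<pi> A B" "\<forall>x\<in>A. (x, \<pi> x) \<in> E ^^ len x" "sum len A \<le> m"
    using assms(1) unfolding transport_def by blast
  obtain \<pi>' len' where 2: "bij_betw \<pi>' B C" "\<forall>x\<in>B. (x, \<pi>' x) \<in> E ^^ len' x" "sum len' B \<le> m'"
    using assms(2) unfolding transport_def by blast
  have "(x, (\<pi>' \<circ> \<pi>) x) \<in> E ^^ (len x + len' (\<pi> x))" if "x \<in> A" for x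
    using that 1 2 by (auto simp: relpow_add bij_betwE intro!: relcompI)
  moreover have "(\<Sum>x\<in>A. len x + len' (\<pi> x)) \<le> m + m'"
    using 1(3) 2(3) sum.reindex_bij_betw[OF 1(1), of len'] by (simp add: sum.distrib)
  ultimately show ?thesis
    unfolding transport_def using bij_betw_trans[OF 1(1) 2(1)]
    by (intro exI[of _ "\<pi>' \<circ> \<pi>"] exI[of _ "\<lambda>x. len x + len' (\<pi> x)"]) blast
qed

lemma transport_Un:
  assumes "transport E A B m" and "transport E A' B' m'" and "A \<inter> A' = {}" and "B \<inter> B' = {}"
    and "finite A" and "finite A'"
  shows "transport E (A \<union> A') (B \<union> B') (m + m')"
proof -
  obtain \<pi> len where 1: "bij_betw \<pi> A B" "\<forall>x\<in>A. (x, \<pi> x) \<in> E ^^ len x" "sum len A \<le> m"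
    using assms(1) unfolding transport_def by blast
  obtain \<pi>' len' where 2: "bij_betw \<pi>' A' B'" "\<forall>x\<in>A'. (x, \<pi>' x) \<in> E ^^ len' x" "sum len' A' \<le> m'"
    using assms(2) unfolding transport_def by blast
  define \<rho> where "\<rho> x = (if x \<in> A then \<pi> x else \<pi>' x)" for x
  define k where "k x = (if x \<in> A then len x else len' x)" for x
  have "bij_betw \<rho> A B" using 1(1) by (subst bij_betw_cong[of A \<rho> \<pi>]) (auto simp: \<rho>_def)
  moreover have "bij_betw \<rho> A' B'"
    using 2(1) assms(3) by (subst bij_betw_cong[of A' \<rho> \<pi>']) (auto simp: \<rho>_def)
  ultimately have "bij_betw \<rho> (A \<union> A') (B \<union> B')" using assms(4) by (rule bij_betw_combine)
  moreover have "\<forall>x\<in>A \<union> A'. (x, \<rho> x) \<in> E ^^ k x" using 1(2) 2(2) by (auto simp: \<rho>_def k_def)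
  moreover have "sum k (A \<union> A') \<le> m + m'"
  proof -
    have "sum k A = sum len A" by (rule sum.cong) (auto simp: k_def)
    moreover have "sum k A' = sum len' A'" using assms(3) by (intro sum.cong) (auto simp: k_def)
    ultimately show ?thesis
      using sum.union_disjoint[OF assms(5,6,3), of k] 1(3) 2(3) by simp
  qed
  ultimately show ?thesis unfolding transport_def by blast
qed

lemma transport_UNION:
  assumes "finite I" and "\<And>i. i \<in> I \<Longrightarrow> transport E (A i) (B i) (m i)" and "\<And>i. i \<in> I \<Longrightarrow> finite (A i)"
    and "disjoint_family_on A I" and "disjoint_family_on B I"
  shows "transport E (\<Union>(A ` I)) (\<Union>(B ` I)) (sum m I)"
  using assms
proof (induction I rule: finite_induct)
  case empty
  then show ?case by (simp add: transport_refl)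
next
  case (insert i I)
  have "transport E (A i \<union> \<Union>(A ` I)) (B i \<union> \<Union>(B ` I)) (m i + sum m I)"
    using insert by (intro transport_Un insert.IH) (auto simp: disjoint_family_on_def)
  then show ?case using insert by simp
qed

text \<open>\<open>h\<close> has to preserve paths only between \<open>A\<close> and
  \<open>B\<close>: the embedding of a line into the grid respects jumps only up to the end of the
  line.\<close>

lemma transport_image:
  assumes "transport E A B m" and "inj_on h A" and "inj_on h B"
    and "\<And>x y k. x \<in> A \<Longrightarrow> y \<in> B \<Longrightarrow> (x, y) \<in> E ^^ k \<Longrightarrow> (h x, h y) \<in> E' ^^ k"
  shows "transport E' (h ` A) (h ` B) m"
proof -
  obtain \<pi> len where 1: "bij_betw \<pi> A B" "\<forall>x\<in>A. (x, \<pi> x) \<in> E ^^ len x" "sum len A \<le> m"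
    using assms(1) unfolding transport_def by blast
  define g where "g = the_inv_into A h"
  have g: "g (h x) = x" if "x \<in> A" for x
    unfolding g_def using the_inv_into_f_f[OF assms(2) that] .
  have "bij_betw g (h ` A) A" unfolding g_def
    using assms(2) by (intro bij_betw_the_inv_into) (simp add: bij_betw_def)
  moreover have "bij_betw h B (h ` B)" using assms(3) by (simp add: bij_betw_def)
  ultimately have "bij_betw (h \<circ> \<pi> \<circ> g) (h ` A) (h ` B)" using 1(1) by (meson bij_betw_trans)
  moreover have "\<forall>y\<in>h ` A. (y, (h \<circ> \<pi> \<circ> g) y) \<in> E' ^^ (len \<circ> g) y"
    using 1 g assms(4) bij_betwE by fastforce
  moreover have "sum (len \<circ> g) (h ` A) \<le> m"
    using 1(3) g by (simp add: sum.reindex[OF assms(2)])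
  ultimately show ?thesis unfolding transport_def by blast
qed

section \<open>Jumps by powers of two and the sorting of an alternating block\<close>

definition pow2_edges :: "(nat \<times> nat) set" where
  "pow2_edges = {(x, x + 2 ^ a) |x a. True}"

lemma relpow_map:
  assumes "(x, y) \<in> E ^^ k" and "\<And>x y. (x, y) \<in> E \<Longrightarrow> (h x, h y) \<in> E'"
  shows "(h x, h y) \<in> E' ^^ k"
  using assms(1) by (induction k arbitrary: y) (auto intro: assms(2))

lemma pow2_edges_double: "(x, y) \<in> pow2_edges \<Longrightarrow> (2 * x + r, 2 * y + r) \<in> pow2_edges"
  unfolding pow2_edges_def by (auto simp: algebra_simps simp flip: power_Suc)

lemma pow2_relpow_double: "(x, y) \<in> pow2_edges ^^ k \<Longrightarrow> (2 * x + r, 2 * y + r) \<in> pow2_edges ^^ k"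
  by (rule relpow_map[where E=pow2_edges and h="\<lambda>x. 2 * x + r"]) (auto intro: pow2_edges_double)

lemma transport_shift:
  assumes "finite A" and "\<And>x. (x, x + s) \<in> E ^^ k"
  shows "transport E A ((\<lambda>x::nat. x + s) ` A) (k * card A)"
  unfolding transport_def using assms
  by (intro exI[of _ "\<lambda>x. x + s"] exI[of _ "\<lambda>_. k"]) (auto simp: bij_betw_def)

lemma pow2_step: "(x, x + 2 ^ a) \<in> pow2_edges ^^ 1"
  by (auto simp: pow2_edges_def)

lemma pow2_step2: "(x, x + (2 ^ a + 1)) \<in> pow2_edges ^^ 2"
proof -
  have "(x + 2 ^ a, x + 2 ^ a + 2 ^ 0) \<in> pow2_edges" "(x, x + 2 ^ a) \<in> pow2_edges"
    unfolding pow2_edges_def by blast+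
  then show ?thesis by (auto simp: numeral_2_eq_2)
qed

text \<open>For \<open>j > 0\<close>, half of the ones already occupy the even offsets of the target
  block. Each of the others reaches an odd offset by a jump of \<open>2 ^ j\<close> and a unit jump,
  so the average is one jump per one. For \<open>j = 0\<close> a single unit jump suffices.\<close>

lemma transport_alternating_pow2:
  "transport pow2_edges ((\<lambda>i. b + 2 * i) ` {..<2 ^ j}) {b + 2 ^ j..<b + 2 * 2 ^ j} (2 ^ j)"
proof (cases j)
  case 0
  then show ?thesis
    using transport_shift[where A="{b}" and s=1 and E=pow2_edges and k=1] pow2_step[of _ 0]
    by (simp add: lessThan_Suc atLeastLessThanSuc)
next
  case (Suc h)
  define A where "A = (\<lambda>i. b + 2 * i) ` {..<(2::nat) ^ h}"
  define A' where "A' = (\<lambda>i. b + 2 * i) ` {2 ^ h..<2 * (2::nat) ^ h}"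
  have "card A = 2 ^ h" unfolding A_def by (subst card_image) (auto intro: inj_onI)
  then have "transport pow2_edges A ((\<lambda>x. x + (2 ^ j + 1)) ` A) (2 * 2 ^ h)"
    using transport_shift[where A=A and s="2 ^ j + 1" and E=pow2_edges and k=2] pow2_step2 by (simp add: A_def)
  moreover have "A \<inter> A' = {}" by (auto simp: A_def A'_def)
  moreover have "(\<lambda>x. x + (2 ^ j + 1)) ` A \<inter> A' = {}"
    by (auto simp: A_def A'_def Suc) presburger
  ultimately have "transport pow2_edges (A \<union> A') ((\<lambda>x. x + (2 ^ j + 1)) ` A \<union> A') (2 * 2 ^ h + 0)"
    by (intro transport_Un transport_refl) (auto simp: A_def A'_def)
  moreover have "A \<union> A' = (\<lambda>i. b + 2 * i) ` {..<2 ^ j}"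
    unfolding A_def A'_def image_Un[symmetric] Suc by (intro arg_cong[where f="image _"]) auto
  moreover have "(\<lambda>x. x + (2 ^ j + 1)) ` A \<union> A' = {b + 2 ^ j..<b + 2 * 2 ^ j}"
  proof (intro equalityI subsetI)
    fix x assume x: "x \<in> {b + 2 ^ j..<b + 2 * 2 ^ j}"
    define y where "y = x - b - 2 ^ j"
    have y: "x = b + 2 ^ j + y" "y < 2 * 2 ^ h" using x by (auto simp: y_def Suc)
    show "x \<in> (\<lambda>x. x + (2 ^ j + 1)) ` A \<union> A'"
    proof (cases "even y")
      case True
      then obtain z where "y = 2 * z" by blast
      then have "x = b + 2 * (2 ^ h + z)" "2 ^ h + z \<in> {2 ^ h..<2 * 2 ^ h}" using y by (auto simp: Suc)
      then have "x \<in> A'" unfolding A'_def by (rule image_eqI)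
      then show ?thesis ..
    next
      case False
      then obtain z where "y = 2 * z + 1" by (metis oddE)
      then have "x = b + 2 * z + (2 ^ j + 1)" "z < 2 ^ h" using y by auto
      then show ?thesis by (auto simp: A_def)
    qed
  qed (auto simp: A_def A'_def Suc)
  ultimately show ?thesis by (simp add: Suc)
qed

text \<open>
  The ones of the pattern $(10)^q$ starting at \<open>b\<close> move to those of $0^q1^q$. Splitting off the largest power
  of two \<open>2 ^ j \<le> q\<close> keeps the cost linear: the two sorted blocks merge by single jumps of length \<open>2 ^ j\<close>.
\<close>

lemma transport_alternating:
  "transport pow2_edges ((\<lambda>i. b + 2 * i) ` {..<q}) {b + q..<b + 2 * q} (2 * q)"
proof (induction q arbitrary: b rule: less_induct)
  case (less q)
  show ?case
  proof (cases "q = 0")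
    case True
    then show ?thesis by (simp add: transport_refl)
  next
    case False
    then obtain j where j: "2 ^ j \<le> q" "q < 2 ^ (j + 1)"
      using ex_power_ivl1[of 2 q] by auto
    define Q :: nat where "Q = 2 ^ j"
    define q' where "q' = q - Q"
    have q: "q = Q + q'" "q' < Q" "0 < Q" using j by (auto simp: Q_def q'_def)
    have 1: "transport pow2_edges ((\<lambda>i. b + 2 * i) ` {..<Q} \<union> (\<lambda>i. (b + 2 * Q) + 2 * i) ` {..<q'})
        ({b + Q..<b + 2 * Q} \<union> {(b + 2 * Q) + q'..<(b + 2 * Q) + 2 * q'}) (Q + 2 * q')"
      using q by (intro transport_Un less.IH) (auto simp: Q_def transport_alternating_pow2)
    \<comment> \<open>Between the two sorted blocks there is a gap of \<open>q'\<close> zeros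
      starting at \<open>b + 2 * Q\<close>. The first \<open>q'\<close> ones jump into it, and all
      other ones stay.\<close>
    have "transport pow2_edges {b + Q..<b + Q + q'} ((\<lambda>x. x + Q) ` {b + Q..<b + Q + q'}) (1 * card {b + Q..<b + Q + q'})"
      unfolding Q_def by (intro transport_shift pow2_step) auto
    moreover have "(\<lambda>x. x + Q) ` {b + Q..<b + Q + q'} = {b + 2 * Q..<b + 2 * Q + q'}"
      by (simp add: mult_2 add.assoc add.commute add.left_commute)
    ultimately have "transport pow2_edges {b + Q..<b + Q + q'} {b + 2 * Q..<b + 2 * Q + q'} q'"
      by simp
    then have 2: "transport pow2_edges ({b + Q..<b + Q + q'} \<union> ({b + Q + q'..<b + 2 * Q} \<union> {b + 2 * Q + q'..<b + 2 * Q + 2 * q'}))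
       ({b + 2 * Q..<b + 2 * Q + q'} \<union> ({b + Q + q'..<b + 2 * Q} \<union> {b + 2 * Q + q'..<b + 2 * Q + 2 * q'})) (q' + 0)"
      using q by (intro transport_Un transport_refl) auto
    have eqm: "{b + Q..<b + 2 * Q} \<union> {(b + 2 * Q) + q'..<(b + 2 * Q) + 2 * q'}
      = {b + Q..<b + Q + q'} \<union> ({b + Q + q'..<b + 2 * Q} \<union> {b + 2 * Q + q'..<b + 2 * Q + 2 * q'})"
      using q by auto
    have "transport pow2_edges ((\<lambda>i. b + 2 * i) ` {..<Q} \<union> (\<lambda>i. (b + 2 * Q) + 2 * i) ` {..<q'})
       ({b + 2 * Q..<b + 2 * Q + q'} \<union> ({b + Q + q'..<b + 2 * Q} \<union> {b + 2 * Q + q'..<b + 2 * Q + 2 * q'})) (Q + 2 * q' + (q' + 0))"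
      using transport_trans[OF 1[unfolded eqm] 2] .
    moreover have "(\<lambda>i. b + 2 * i) ` {..<Q} \<union> (\<lambda>i. (b + 2 * Q) + 2 * i) ` {..<q'} = (\<lambda>i. b + 2 * i) ` {..<q}"
    proof (intro equalityI subsetI)
      fix x assume "x \<in> (\<lambda>i. b + 2 * i) ` {..<q}"
      then obtain i where i: "x = b + 2 * i" "i < q" by blast
      show "x \<in> (\<lambda>i. b + 2 * i) ` {..<Q} \<union> (\<lambda>i. (b + 2 * Q) + 2 * i) ` {..<q'}"
      proof (cases "i < Q")
        case False
        then have "x = (b + 2 * Q) + 2 * (i - Q)" "i - Q < q'" using i q by auto
        then show ?thesis by blast
      qed (use i in auto)
    next
      fix x assume "x \<in> (\<lambda>i. b + 2 * i) ` {..<Q} \<union> (\<lambda>i. (b + 2 * Q) + 2 * i) ` {..<q'}"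
      then show "x \<in> (\<lambda>i. b + 2 * i) ` {..<q}"
      proof
        assume "x \<in> (\<lambda>i. (b + 2 * Q) + 2 * i) ` {..<q'}"
        then obtain i where "x = b + 2 * (Q + i)" "i < q'" by auto
        then show ?thesis using q by (intro image_eqI[of _ _ "Q + i"]) auto
      qed (use q in auto)
    qed
    moreover have "{b + 2 * Q..<b + 2 * Q + q'} \<union> ({b + Q + q'..<b + 2 * Q} \<union> {b + 2 * Q + q'..<b + 2 * Q + 2 * q'})
       = {b + q..<b + 2 * q}"
      using q by auto
    \<comment> \<open>The total cost \<open>Q + 3 * q'\<close> is at most \<open>2 * q\<close>
      because \<open>q' < Q\<close>.\<close>
    ultimately show ?thesis using q by (auto elim!: transport_mono)
  qed
qed

section \<open>Violations on a line and the cost of sorting it\<close>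

definition line_violations :: "nat \<Rightarrow> nat set \<Rightarrow> (nat \<times> nat) set" where
  "line_violations L A = {(x, y) \<in> pow2_edges. x \<in> A \<and> y < L \<and> y \<notin> A}"

lemma finite_line_violations: "finite (line_violations L A)"
  by (rule finite_subset[of _ "{..<L} \<times> {..<L}"]) (auto simp: line_violations_def pow2_edges_def)

text \<open>Doubling turns a jump of \<open>2 ^ a\<close> into one of \<open>2 ^ (a + 1)\<close>, so
  violations within the even or within the odd positions have even length and are disjoint from the
  unit edges in \<open>V\<close>. The former pay for the recursive calls of the sort, the latter for
  the merge.\<close>

lemma line_violations_split:
  assumes "V \<subseteq> line_violations L A" and "\<And>x y. (x, y) \<in> V \<Longrightarrow> y = x + 1"
  shows "card (line_violations ((L + 1) div 2) {j. 2 * j \<in> A})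
       + card (line_violations (L div 2) {j. 2 * j + 1 \<in> A}) + card V \<le> card (line_violations L A)"
proof -
  define h where "h r = (\<lambda>(x, y). (2 * x + r, 2 * y + r :: nat))" for r :: nat
  define V0 where "V0 = h 0 ` line_violations ((L + 1) div 2) {j. 2 * j \<in> A}"
  define V1 where "V1 = h 1 ` line_violations (L div 2) {j. 2 * j + 1 \<in> A}"
  have c: "card V0 = card (line_violations ((L + 1) div 2) {j. 2 * j \<in> A})"
    "card V1 = card (line_violations (L div 2) {j. 2 * j + 1 \<in> A})"
    unfolding V0_def V1_def by (intro card_image inj_onI; auto simp: h_def)+
  have sub: "V0 \<subseteq> line_violations L A" "V1 \<subseteq> line_violations L A"
    unfolding V0_def V1_def
    using pow2_edges_double[of _ _ 0] pow2_edges_double[of _ _ 1]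
    by (auto simp: h_def line_violations_def)
  have disj: "V0 \<inter> V1 = {}"
    unfolding V0_def V1_def h_def by (auto, presburger)
  have "e \<notin> V" if "e \<in> V0 \<union> V1" for e
  proof
    assume "e \<in> V"
    have "\<exists>r x y. e = (2 * x + r, 2 * y + r)" using that unfolding V0_def V1_def h_def
      by (metis (no_types, lifting) Un_iff image_iff case_prod_beta)
    then obtain x y r where "e = (2 * x + r, 2 * y + r)" by blast
    then have "2 * y + r = 2 * x + r + 1" using assms(2) \<open>e \<in> V\<close> by blast
    then show False by presburger
  qed
  then have disjV: "(V0 \<union> V1) \<inter> V = {}" by blast
  have fin: "finite V0" "finite V1" "finite V"
    using sub assms(1) finite_line_violations finite_subset by blast+
  have "card V0 + card V1 + card V = card (V0 \<union> V1 \<union> V)"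
    using fin disj disjV by (simp add: card_Un_disjoint)
  also have "\<dots> \<le> card (line_violations L A)"
    using sub assms(1) finite_line_violations by (intro card_mono) auto
  finally show ?thesis using c by simp
qed

lemma card_diff_ge:
  fixes P Q :: "nat \<Rightarrow> bool"
  shows "card {j. j < m \<and> \<not> Q j} \<le> card {j. j < m \<and> P j \<and> \<not> Q j} + card {j. j < m \<and> \<not> P j}"
proof -
  have "{j. j < m \<and> \<not> Q j} \<subseteq> {j. j < m \<and> P j \<and> \<not> Q j} \<union> {j. j < m \<and> \<not> P j}" by auto
  then have "card {j. j < m \<and> \<not> Q j} \<le> card ({j. j < m \<and> P j \<and> \<not> Q j} \<union> {j. j < m \<and> \<not> P j})"
    by (intro card_mono) auto
  also have "\<dots> \<le> card {j. j < m \<and> P j \<and> \<not> Q j} + card {j. j < m \<and> \<not> P j}" by (rule card_Un_le)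
  finally show ?thesis .
qed

lemma card_zeros:
  assumes "A \<subseteq> {..<m::nat}"
  shows "card {j. j < m \<and> j \<notin> A} = m - card A"
proof -
  have "{j. j < m \<and> j \<notin> A} = {..<m} - A" by auto
  then show ?thesis using card_Diff_subset[OF finite_subset[OF assms] assms] by simp
qed

text \<open>\<open>p\<close> and \<open>p'\<close> count the zeros on even and on odd positions
  after each class has been sorted. From \<open>2 * p\<close> to \<open>2 * p'\<close> the even
  positions carry ones and the odd ones still carry zeros.\<close>

lemma interleave_even_first:
  assumes "p \<le> p'" "2 * p' \<le> (L::nat)"
  shows "{x. x < L \<and> (if even x then 2 * p \<le> x else 2 * p' + 1 \<le> x)}
    = (\<lambda>i. 2 * p + 2 * i) ` {..<p' - p} \<union> {2 * p'..<L}" (is "?G = ?A \<union> ?B")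
proof (rule set_eqI)
  fix x :: nat
  obtain z where z: "x = 2 * z \<or> x = 2 * z + 1" by (metis evenE oddE)
  have "x \<in> ?A \<longleftrightarrow> x = 2 * z \<and> p \<le> z \<and> z < p'"
  proof
    assume "x \<in> ?A"
    then obtain i where "x = 2 * (p + i)" "i < p' - p" by auto
    moreover from this z have "x = 2 * z" by presburger
    ultimately show "x = 2 * z \<and> p \<le> z \<and> z < p'" by simp
  next
    assume "x = 2 * z \<and> p \<le> z \<and> z < p'"
    then show "x \<in> ?A" by (intro image_eqI[of _ _ "z - p"]) auto
  qed
  then show "x \<in> ?G \<longleftrightarrow> x \<in> ?A \<union> ?B" using z assms by auto
qed

text \<open>The block now starts at an odd position. It has one pair fewer than
  \<open>p - p'\<close>, since a one at \<open>2 * p - 1\<close> already belongs to the final run of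
  ones.\<close>

lemma interleave_odd_first:
  assumes "p' < p" "2 * p \<le> L + (1::nat)"
  shows "{x. x < L \<and> (if even x then 2 * p \<le> x else 2 * p' + 1 \<le> x)}
    = (\<lambda>i. 2 * p' + 1 + 2 * i) ` {..<p - 1 - p'} \<union> {2 * p - 1..<L}" (is "?G = ?A \<union> ?B")
proof (rule set_eqI)
  fix x :: nat
  obtain z where z: "x = 2 * z \<or> x = 2 * z + 1" by (metis evenE oddE)
  have "x \<in> ?A \<longleftrightarrow> x = 2 * z + 1 \<and> p' \<le> z \<and> z + 1 < p"
  proof
    assume "x \<in> ?A"
    then obtain i where "x = 2 * (p' + i) + 1" "i < p - 1 - p'" by auto
    moreover from this z have "x = 2 * z + 1" by presburger
    ultimately show "x = 2 * z + 1 \<and> p' \<le> z \<and> z + 1 < p" by simp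
  next
    assume "x = 2 * z + 1 \<and> p' \<le> z \<and> z + 1 < p"
    then show "x \<in> ?A" by (intro image_eqI[of _ _ "z - p'"]) auto
  qed
  then show "x \<in> ?G \<longleftrightarrow> x \<in> ?A \<union> ?B" using z assms by auto
qed
text \<open>The even and the odd positions are shorter lines, sorted by induction. What remains is
  one alternating block with \<open>q\<close> ones, which costs \<open>2 * q\<close>, and
  \<open>A\<close> itself has at least \<open>q\<close> violated unit edges to pay for it.\<close>

lemma transport_sort_line:
  assumes "A \<subseteq> {..<L}"
  shows "transport pow2_edges A {L - card A..<L} (2 * card (line_violations L A))"
  using assms
proof (induction L arbitrary: A rule: less_induct)
  case (less L)
  show ?case
  proof (cases "L \<le> 1")
    case True
    then have "A = {} \<or> (L = 1 \<and> A = {0})" using less.prems by (cases L) auto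
    then have "{L - card A..<L} = A" by auto
    then show ?thesis by (simp add: transport_refl)
  next
    case False
    define Le where "Le = (L + 1) div 2"
    define Lo where "Lo = L div 2"
    define Ae where "Ae = {j. 2 * j \<in> A}"
    define Ao where "Ao = {j. 2 * j + 1 \<in> A}"
    define p where "p = Le - card Ae"
    define p' where "p' = Lo - card Ao"
    have L: "L = Le + Lo" "Lo \<le> Le" "Le \<le> Lo + 1" "Le < L" "Lo < L"
      using False by (auto simp: Le_def Lo_def)
    have Ae: "Ae \<subseteq> {..<Le}" and Ao: "Ao \<subseteq> {..<Lo}"
      using less.prems by (auto simp: Ae_def Ao_def Le_def Lo_def)
    have cle: "card Ae \<le> Le" "card Ao \<le> Lo"
      using card_mono[OF _ Ae] card_mono[OF _ Ao] by auto
    have finA: "finite Ae" "finite Ao" using Ae Ao finite_subset by blast+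
    have Asplit: "A = (\<lambda>j. 2 * j + 0) ` Ae \<union> (\<lambda>j. 2 * j + 1) ` Ao"
    proof (intro equalityI subsetI)
      fix x assume "x \<in> A"
      then show "x \<in> (\<lambda>j. 2 * j + 0) ` Ae \<union> (\<lambda>j. 2 * j + 1) ` Ao"
        by (cases "even x") (auto simp: Ae_def Ao_def elim!: evenE oddE)
    qed (auto simp: Ae_def Ao_def)
    have cA: "card A = card Ae + card Ao"
    proof -
      have "card A = card ((\<lambda>j. 2 * j + 0) ` Ae) + card ((\<lambda>j. 2 * j + 1) ` Ao)"
        unfolding Asplit using finA by (subst card_Un_disjoint) (auto, presburger)
      then show ?thesis by (simp add: card_image inj_on_def)
    qed
    define v where "v = card (line_violations Le Ae) + card (line_violations Lo Ao)"
    define G where "G = (\<lambda>j. 2 * j + 0) ` {p..<Le} \<union> (\<lambda>j. 2 * j + 1) ` {p'..<Lo}"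
    have "transport pow2_edges A G (2 * card (line_violations Le Ae) + 2 * card (line_violations Lo Ao))"
      unfolding Asplit G_def
    proof (rule transport_Un)
      show "transport pow2_edges ((\<lambda>j. 2 * j + 0) ` Ae) ((\<lambda>j. 2 * j + 0) ` {p..<Le}) (2 * card (line_violations Le Ae))"
        unfolding p_def using less.IH[OF L(4) Ae]
        by (rule transport_image) (auto intro: inj_onI dest: pow2_relpow_double[where r=0])
      show "transport pow2_edges ((\<lambda>j. 2 * j + 1) ` Ao) ((\<lambda>j. 2 * j + 1) ` {p'..<Lo}) (2 * card (line_violations Lo Ao))"
        unfolding p'_def using less.IH[OF L(5) Ao]
        by (rule transport_image) (auto intro: inj_onI dest: pow2_relpow_double[where r=1])
    qed (use finA in \<open>auto, presburger+\<close>)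
    then have tG: "transport pow2_edges A G (2 * v)" by (simp add: v_def)
    have zeros: "L - card A = p + p'" using cA L(1) cle by (simp add: p_def p'_def)
    have memG: "x \<in> G \<longleftrightarrow> x < L \<and> (if even x then 2 * p \<le> x else 2 * p' + 1 \<le> x)" for x
    proof (cases "even x")
      case True
      then obtain z where "x = 2 * z" by blast
      moreover from this have "x \<in> G \<longleftrightarrow> z \<in> {p..<Le}" unfolding G_def by auto presburger+
      moreover have "z < Le \<longleftrightarrow> 2 * z < L" by (auto simp: Le_def)
      ultimately show ?thesis by auto
    next
      case False
      then obtain z where "x = 2 * z + 1" by (metis oddE)
      moreover from this have "x \<in> G \<longleftrightarrow> z \<in> {p'..<Lo}" unfolding G_def by auto presburger+
      moreover have "z < Lo \<longleftrightarrow> 2 * z + 1 < L" by (auto simp: Lo_def)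
      ultimately show ?thesis by auto
    qed
    have G_eq: "G = {x. x < L \<and> (if even x then 2 * p \<le> x else 2 * p' + 1 \<le> x)}"
      by (rule set_eqI) (simp only: memG mem_Collect_eq)
    have finish: ?thesis
      if "transport pow2_edges G {L - card A..<L} (2 * q)" "q \<le> card V" "V \<subseteq> line_violations L A"
        "\<And>x y. (x, y) \<in> V \<Longrightarrow> y = x + 1" for q V
    proof -
      have "v + card V \<le> card (line_violations L A)"
        using line_violations_split[OF that(3,4)] by (simp add: v_def Le_def Lo_def Ae_def Ao_def)
      then show ?thesis using transport_mono[OF transport_trans[OF tG that(1)]] that(2) by simp
    qed
    have merge: "transport pow2_edges G {L - card A..<L} (2 * q)"
      if G: "G = (\<lambda>i. b + 2 * i) ` {..<q} \<union> {b + 2 * q..<L}" and b: "L - card A = b + q" "b + 2 * q \<le> L \<or> q = 0" for b q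
    proof -
      have "transport pow2_edges ((\<lambda>i. b + 2 * i) ` {..<q} \<union> {b + 2 * q..<L})
              ({b + q..<b + 2 * q} \<union> {b + 2 * q..<L}) (2 * q + 0)"
        by (intro transport_Un transport_alternating transport_refl) auto
      moreover have "{b + q..<b + 2 * q} \<union> {b + 2 * q..<L} = {L - card A..<L}"
        using b by auto
      ultimately show ?thesis using G by simp
    qed
    show ?thesis
    proof (cases "p \<le> p'")
      case True
      define q where "q = p' - p"
      define V where "V = (\<lambda>j. (2 * j, 2 * j + 1)) ` {j. j < Lo \<and> j \<in> Ae \<and> j \<notin> Ao}"
      have pL: "2 * p' \<le> L" by (simp add: p'_def Lo_def)
      have pq: "2 * p + 2 * q = 2 * p'" using True by (simp add: q_def)
      have "G = (\<lambda>i. 2 * p + 2 * i) ` {..<q} \<union> {2 * p + 2 * q..<L}"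
        unfolding G_eq pq unfolding q_def by (rule interleave_even_first[OF True pL])
      moreover have "2 * p + 2 * q \<le> L" using pq pL by simp
      moreover have "L - card A = 2 * p + q" using zeros True by (simp add: q_def)
      ultimately have "transport pow2_edges G {L - card A..<L} (2 * q)" by (intro merge) auto
      moreover have "q \<le> card V"
      proof -
        \<comment> \<open>The odd positions have \<open>p' - p\<close> more zeros than the even
          ones, so at least that many pairs of positions \<open>2 * j\<close>,
          \<open>2 * j + 1\<close> carry a one followed by a zero.\<close>
        have "card {j. j < Lo \<and> j \<notin> Ae} \<le> card {j. j < Le \<and> j \<notin> Ae}" using L by (intro card_mono) auto
        then have "p' \<le> card {j. j < Lo \<and> j \<in> Ae \<and> j \<notin> Ao} + p"
          using card_diff_ge[of Lo "\<lambda>j. j \<in> Ao" "\<lambda>j. j \<in> Ae"] card_zeros[OF Ae] card_zeros[OF Ao]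
          by (simp add: p_def p'_def)
        moreover have "card V = card {j. j < Lo \<and> j \<in> Ae \<and> j \<notin> Ao}"
          unfolding V_def by (intro card_image inj_onI) auto
        ultimately show ?thesis by (simp add: q_def)
      qed
      moreover have "V \<subseteq> line_violations L A"
        by (auto simp: V_def line_violations_def pow2_edges_def Ae_def Ao_def Lo_def intro: exI[of _ 0])
      ultimately show ?thesis by (rule finish) (auto simp: V_def)
    next
      case False
      define q where "q = p - 1 - p'"
      define V where "V = (\<lambda>j. (2 * j + 1, 2 * j + 2)) ` {j. j < Le - 1 \<and> j \<in> Ao \<and> Suc j \<notin> Ae}"
      have pL: "2 * p \<le> L + 1" by (simp add: p_def Le_def)
      have pq: "(2 * p' + 1) + 2 * q = 2 * p - 1" using False by (simp add: q_def)
      have "G = (\<lambda>i. (2 * p' + 1) + 2 * i) ` {..<q} \<union> {(2 * p' + 1) + 2 * q..<L}"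
        unfolding G_eq pq unfolding q_def using False by (intro interleave_odd_first[OF _ pL]) simp
      moreover have "(2 * p' + 1) + 2 * q \<le> L \<or> q = 0" using pq pL by linarith
      moreover have "L - card A = (2 * p' + 1) + q" using zeros False by (simp add: q_def)
      ultimately have "transport pow2_edges G {L - card A..<L} (2 * q)" by (intro merge) auto
      moreover have "q \<le> card V"
      proof -
        have "card {j. j < Le - 1 \<and> j \<notin> Ao} \<le> card {j. j < Lo \<and> j \<notin> Ao}" using L by (intro card_mono) auto
        \<comment> \<open>Position \<open>0\<close> has no odd predecessor. The zero that may be
          lost there is the \<open>1\<close> subtracted in \<open>q\<close>.\<close>
        moreover have "card {j. j < Le \<and> j \<notin> Ae} \<le> card {j. j < Le - 1 \<and> Suc j \<notin> Ae} + 1"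
        proof -
          have "{j. j < Le \<and> j \<notin> Ae} \<subseteq> insert 0 (Suc ` {j. j < Le - 1 \<and> Suc j \<notin> Ae})"
          proof
            fix j assume "j \<in> {j. j < Le \<and> j \<notin> Ae}"
            then show "j \<in> insert 0 (Suc ` {j. j < Le - 1 \<and> Suc j \<notin> Ae})" by (cases j) auto
          qed
          then have "card {j. j < Le \<and> j \<notin> Ae} \<le> card (insert 0 (Suc ` {j. j < Le - 1 \<and> Suc j \<notin> Ae}))"
            by (intro card_mono) auto
          also have "\<dots> \<le> Suc (card (Suc ` {j. j < Le - 1 \<and> Suc j \<notin> Ae}))" by (intro card_insert_le_m1) auto
          finally show ?thesis by (simp add: card_image)
        qed
        ultimately have "p \<le> card {j. j < Le - 1 \<and> j \<in> Ao \<and> Suc j \<notin> Ae} + p' + 1"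
          using card_diff_ge[of "Le - 1" "\<lambda>j. Suc j \<in> Ae" "\<lambda>j. j \<in> Ao"] card_zeros[OF Ae] card_zeros[OF Ao]
          by (simp add: p_def p'_def)
        moreover have "card V = card {j. j < Le - 1 \<and> j \<in> Ao \<and> Suc j \<notin> Ae}"
          unfolding V_def by (intro card_image inj_onI) auto
        ultimately show ?thesis by (simp add: q_def)
      qed
      moreover have "V \<subseteq> line_violations L A"
        by (auto simp: V_def line_violations_def pow2_edges_def Ae_def Ao_def Le_def intro!: exI[of _ 0])
      ultimately show ?thesis by (rule finish) (auto simp: V_def)
    qed
  qed
qed

section \<open>Sorting the grid\<close>

lemma grid_upd: "x \<in> grid n d \<Longrightarrow> i < d \<Longrightarrow> x(i := v) \<in> grid n d \<longleftrightarrow> v \<in> {1..n}"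
  unfolding grid_def PiE_def extensional_def Pi_def by auto

lemma grid_range: "x \<in> grid n d \<Longrightarrow> i < d \<Longrightarrow> 1 \<le> x i \<and> x i \<le> n"
  unfolding grid_def by (auto simp: PiE_iff)

definition dir_edges :: "nat \<Rightarrow> nat \<Rightarrow> nat \<Rightarrow> ((nat \<Rightarrow> nat) \<times> (nat \<Rightarrow> nat)) set" where
  "dir_edges n d i = {(x, y). x \<in> grid n d \<and> y \<in> grid n d \<and> (\<exists>a. y = x(i := x i + 2 ^ a))}"

lemma grid_eqI:
  assumes "x \<in> grid n d" "y \<in> grid n d" "\<And>j. j < d \<Longrightarrow> x j = y j"
  shows "x = y"
  using assms unfolding grid_def by (intro PiE_ext[of x "{..<d}" _ y]) auto

lemma aug_edges_eq: "aug_edges n d = (\<Union>i<d. dir_edges n d i)"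
proof -
  have "y = x(i := x i + 2 ^ a) \<longleftrightarrow> y i = x i + 2 ^ a \<and> (\<forall>j<d. j \<noteq> i \<longrightarrow> y j = x j)"
    if g: "x \<in> grid n d" "y \<in> grid n d" and i: "i < d" for x y i a
  proof
    assume *: "y i = x i + 2 ^ a \<and> (\<forall>j<d. j \<noteq> i \<longrightarrow> y j = x j)"
    then have "x(i := x i + 2 ^ a) \<in> grid n d"
      using grid_upd[OF g(1) i] grid_range[OF g(2) i] by simp
    then show "y = x(i := x i + 2 ^ a)" by (rule grid_eqI[OF g(2)]) (use * in auto)
  qed simp
  note key = this
  show ?thesis
  proof (intro set_eqI, clarify)
    fix x y :: "nat \<Rightarrow> nat"
    show "(x, y) \<in> aug_edges n d \<longleftrightarrow> (x, y) \<in> (\<Union>i<d. dir_edges n d i)"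
    proof
      assume "(x, y) \<in> aug_edges n d"
      then obtain i a where "x \<in> grid n d" "y \<in> grid n d" "i < d"
          "y i = x i + 2 ^ a \<and> (\<forall>j<d. j \<noteq> i \<longrightarrow> y j = x j)"
        unfolding aug_edges_def by blast
      moreover from this have "y = x(i := x i + 2 ^ a)" by (intro key[THEN iffD2])
      ultimately have "(x, y) \<in> dir_edges n d i" unfolding dir_edges_def by blast
      then show "(x, y) \<in> (\<Union>i<d. dir_edges n d i)" using \<open>i < d\<close> by blast
    next
      assume "(x, y) \<in> (\<Union>i<d. dir_edges n d i)"
      then obtain i where i: "i < d" "(x, y) \<in> dir_edges n d i" by blast
      then obtain a where g: "x \<in> grid n d" "y \<in> grid n d" and "y = x(i := x i + 2 ^ a)"
        unfolding dir_edges_def by blast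
      then have "y i = x i + 2 ^ a \<and> (\<forall>j<d. j \<noteq> i \<longrightarrow> y j = x j)" by simp
      then show "(x, y) \<in> aug_edges n d" unfolding aug_edges_def using g i(1) by blast
    qed
  qed
qed

lemma finite_dir_edges: "finite (dir_edges n d i)"
  by (rule finite_subset[of _ "grid n d \<times> grid n d"]) (auto simp: dir_edges_def finite_grid)

definition dir_violations :: "nat \<Rightarrow> nat \<Rightarrow> nat \<Rightarrow> (nat \<Rightarrow> nat) set \<Rightarrow> ((nat \<Rightarrow> nat) \<times> (nat \<Rightarrow> nat)) set" where
  "dir_violations n d i F = {(x, y) \<in> dir_edges n d i. x \<in> F \<and> y \<notin> F}"

lemma finite_dir_violations: "finite (dir_violations n d i F)"
  by (rule finite_subset[OF _ finite_dir_edges]) (auto simp: dir_violations_def)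

definition base :: "nat \<Rightarrow> nat \<Rightarrow> nat \<Rightarrow> (nat \<Rightarrow> nat) set" where
  "base n d i = {b \<in> grid n d. b i = 1}"

text \<open>Position \<open>j\<close> on the line is the coordinate value \<open>Suc j\<close>. The
  set does not depend on \<open>b i\<close>, so any point may represent its line.\<close>

definition line_set :: "nat \<Rightarrow> nat \<Rightarrow> (nat \<Rightarrow> nat) set \<Rightarrow> (nat \<Rightarrow> nat) \<Rightarrow> nat set" where
  "line_set n i F b = {j. j < n \<and> b(i := Suc j) \<in> F}"

definition sort_dir :: "nat \<Rightarrow> nat \<Rightarrow> nat \<Rightarrow> (nat \<Rightarrow> nat) set \<Rightarrow> (nat \<Rightarrow> nat) set" where
  "sort_dir n d i F = {x \<in> grid n d. n - card (line_set n i F x) < x i}"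

lemma line_set_upd [simp]: "line_set n i F (b(i := v)) = line_set n i F b"
  by (simp add: line_set_def)

lemma card_line_set: "card (line_set n i F b) \<le> n"
  using card_mono[of "{..<n}" "line_set n i F b"] by (auto simp: line_set_def)

lemma mem_line_set: "j \<in> line_set n i F b \<longleftrightarrow> j < n \<and> b(i := Suc j) \<in> F"
  by (simp add: line_set_def)

lemma line_set_sort_dir:
  assumes "b \<in> grid n d" "i < d"
  shows "line_set n i (sort_dir n d i F) b = {n - card (line_set n i F b)..<n}"
proof (rule set_eqI)
  fix j
  have "j \<in> line_set n i (sort_dir n d i F) b \<longleftrightarrow> j < n \<and> n - card (line_set n i F b) < Suc j"
    using assms by (auto simp: mem_line_set sort_dir_def grid_upd)
  then show "j \<in> line_set n i (sort_dir n d i F) b \<longleftrightarrow> j \<in> {n - card (line_set n i F b)..<n}"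
    by auto
qed

lemma grid_eq_lines:
  assumes "F \<subseteq> grid n d" "i < d"
  shows "F = (\<Union>b\<in>base n d i. (\<lambda>j. b(i := Suc j)) ` line_set n i F b)"
proof (intro equalityI subsetI)
  fix x assume x: "x \<in> F"
  have g: "x \<in> grid n d" using x assms by blast
  have r: "1 \<le> x i" "x i \<le> n" using grid_range[OF g assms(2)] by auto
  have "x(i := 1) \<in> base n d i" using g r assms by (auto simp: base_def grid_upd)
  moreover have "x i - 1 \<in> line_set n i F (x(i := 1))" using r x by (auto simp: line_set_def)
  moreover have "x = (x(i := 1))(i := Suc (x i - 1))" using r by auto
  ultimately show "x \<in> (\<Union>b\<in>base n d i. (\<lambda>j. b(i := Suc j)) ` line_set n i F b)" by blast
qed (auto simp: line_set_def)

text \<open>Jumps only go up, so the bound on the last position keeps the whole path inside the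
  grid.\<close>

lemma pow2_relpow_line:
  assumes "b \<in> grid n d" "i < d" "(x, y) \<in> pow2_edges ^^ k" "y < n"
  shows "(b(i := Suc x), b(i := Suc y)) \<in> dir_edges n d i ^^ k \<and> x \<le> y"
  using assms(3,4)
proof (induction k arbitrary: y)
  case (Suc k)
  obtain z where z: "(x, z) \<in> pow2_edges ^^ k" "(z, y) \<in> pow2_edges" using Suc.prems by auto
  then obtain a where a: "y = z + 2 ^ a" by (auto simp: pow2_edges_def)
  then have "z < n" using Suc.prems(2) by simp
  note IH = Suc.IH[OF z(1) this, THEN conjunct1] Suc.IH[OF z(1) this, THEN conjunct2]
  have "(b(i := Suc z), b(i := Suc y)) \<in> dir_edges n d i"
    using a assms(1,2) Suc.prems(2) by (auto simp: dir_edges_def grid_upd intro!: exI[of _ a])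
  with IH(1) have "(b(i := Suc x), b(i := Suc y)) \<in> dir_edges n d i ^^ Suc k" by (rule relpow_Suc_I)
  moreover have "x \<le> y" using IH(2) a by simp
  ultimately show ?case ..
qed simp

lemma disjoint_lines: "disjoint_family_on (\<lambda>b. (\<lambda>j. b(i := Suc j)) ` A b) (base n d i)"
  unfolding disjoint_family_on_def base_def
proof clarsimp
  fix b b' assume *: "b i = Suc 0" "b' i = Suc 0" "b \<noteq> b'"
  have "b(i := u) \<noteq> b'(i := v)" for u v
    using * by (metis fun_upd_triv fun_upd_upd)
  then show "(\<lambda>j. b(i := Suc j)) ` A b \<inter> (\<lambda>j. b'(i := Suc j)) ` A b' = {}" by blast
qed

lemma relpow_mono_rel:
  fixes R S :: "('a \<times> 'a) set"
  shows "R \<subseteq> S \<Longrightarrow> R ^^ k \<subseteq> S ^^ k"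
proof (induction k)
  case (Suc k)
  show ?case unfolding relpow.simps by (rule relcomp_mono[OF Suc.IH[OF Suc.prems] Suc.prems])
qed simp

lemma transport_subset: "transport E A B m \<Longrightarrow> E \<subseteq> E' \<Longrightarrow> transport E' A B m"
  unfolding transport_def using relpow_mono_rel[of E E'] by (meson subsetD)

lemma sum_line_violations:
  assumes "i < d"
  shows "(\<Sum>b\<in>base n d i. card (line_violations n (line_set n i F b))) \<le> card (dir_violations n d i F)"
proof -
  define h where "h b = (\<lambda>(x, y). (b(i := Suc x), b(i := Suc y)))" for b :: "nat \<Rightarrow> nat"
  define V where "V b = h b ` line_violations n (line_set n i F b)" for b
  have fin: "finite (base n d i)" by (simp add: base_def finite_grid)
  have disj: "V b \<inter> V b' = {}" if "b \<in> base n d i" "b' \<in> base n d i" "b \<noteq> b'" for b b'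
  proof -
    have "b(i := u) \<noteq> b'(i := v)" for u v
      using that by (metis (mono_tags, lifting) base_def fun_upd_triv fun_upd_upd mem_Collect_eq)
    then show ?thesis by (auto simp: V_def h_def)
  qed
  have "card (line_violations n (line_set n i F b)) = card (V b)" for b
    unfolding V_def h_def
    by (intro card_image[symmetric] inj_onI) (auto dest!: fun_cong[where x=i])
  then have "(\<Sum>b\<in>base n d i. card (line_violations n (line_set n i F b))) = (\<Sum>b\<in>base n d i. card (V b))"
    by simp
  also have "\<dots> = card (\<Union>b\<in>base n d i. V b)"
    using fin disj by (intro card_UN_disjoint[symmetric]) (auto simp: V_def finite_line_violations)
  also have "\<dots> \<le> card (dir_violations n d i F)"
  proof (intro card_mono finite_dir_violations)
    have "h b (x, y) \<in> dir_violations n d i F"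
      if b: "b \<in> base n d i" and xy: "(x, y) \<in> line_violations n (line_set n i F b)" for b x y
    proof -
      obtain a where a: "y = x + 2 ^ a" using xy by (auto simp: line_violations_def pow2_edges_def)
      moreover have "y < n" "b(i := Suc x) \<in> F" "b(i := Suc y) \<notin> F" "b \<in> grid n d"
        using xy b by (auto simp: line_violations_def line_set_def base_def)
      ultimately show ?thesis using assms
        by (auto simp: h_def dir_violations_def dir_edges_def grid_upd intro!: exI[of _ a])
    qed
    then show "(\<Union>b\<in>base n d i. V b) \<subseteq> dir_violations n d i F" by (auto simp: V_def)
  qed
  finally show ?thesis .
qed

lemma transport_sort_dir:
  assumes "F \<subseteq> grid n d" "i < d"
  shows "transport (aug_edges n d) F (sort_dir n d i F) (2 * card (dir_violations n d i F))"
proof -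
  have fin: "finite (base n d i)" by (simp add: base_def finite_grid)
  have sub: "sort_dir n d i F \<subseteq> grid n d" by (auto simp: sort_dir_def)
  have "transport (dir_edges n d i) (\<Union>b\<in>base n d i. (\<lambda>j. b(i := Suc j)) ` line_set n i F b)
     (\<Union>b\<in>base n d i. (\<lambda>j. b(i := Suc j)) ` line_set n i (sort_dir n d i F) b)
     (\<Sum>b\<in>base n d i. 2 * card (line_violations n (line_set n i F b)))"
  proof (intro transport_UNION fin disjoint_lines)
    fix b assume "b \<in> base n d i"
    then have b: "b \<in> grid n d" by (simp add: base_def)
    have inj: "inj_on (\<lambda>j. b(i := Suc j)) X" for X
      by (auto intro!: inj_onI dest!: fun_cong[where x=i])
    have "line_set n i F b \<subseteq> {..<n}" by (auto simp: line_set_def)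
    then have "transport pow2_edges (line_set n i F b) {n - card (line_set n i F b)..<n}
        (2 * card (line_violations n (line_set n i F b)))"
      by (rule transport_sort_line)
    then show "transport (dir_edges n d i) ((\<lambda>j. b(i := Suc j)) ` line_set n i F b)
        ((\<lambda>j. b(i := Suc j)) ` line_set n i (sort_dir n d i F) b) (2 * card (line_violations n (line_set n i F b)))"
      unfolding line_set_sort_dir[OF b assms(2)]
      by (rule transport_image[OF _ inj inj]) (use pow2_relpow_line[OF b assms(2)] in auto)
  qed (simp add: line_set_def)
  then have "transport (dir_edges n d i) F (sort_dir n d i F)
     (\<Sum>b\<in>base n d i. 2 * card (line_violations n (line_set n i F b)))"
    using grid_eq_lines[OF assms] grid_eq_lines[OF sub assms(2)] by metis
  then have "transport (dir_edges n d i) F (sort_dir n d i F) (2 * card (dir_violations n d i F))"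
    by (rule transport_mono) (use sum_line_violations[OF assms(2), of n F] in \<open>simp add: sum_distrib_left[symmetric]\<close>)
  then show ?thesis
    by (rule transport_subset) (use assms(2) in \<open>auto simp: aug_edges_eq\<close>)
qed

text \<open>An edge in direction \<open>j\<close> pairs two parallel lines of direction
  \<open>i\<close>, represented by the points \<open>b\<close> and \<open>b'\<close> whose
  coordinate \<open>i\<close> is \<open>1\<close>. A violation on this pair is a position that has a
  one on the lower line and a zero on the upper line.\<close>

lemma card_dir_violations:
  assumes "j < d" "i < d" "i \<noteq> j"
  shows "card (dir_violations n d j F) =
    (\<Sum>(b, b')\<in>{(b, b') \<in> dir_edges n d j. b i = 1}. card (line_set n i F b - line_set n i F b'))"
proof -
  define P where "P = {(b, b') \<in> dir_edges n d j. b i = 1}"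
  define V where "V = (\<lambda>(b, b'). (\<lambda>v. (b(i := Suc v), b'(i := Suc v))) ` (line_set n i F b - line_set n i F b'))"
  have finP: "finite P" by (rule finite_subset[OF _ finite_dir_edges]) (auto simp: P_def)
  have one: "b i = 1 \<and> b' i = 1" if "(b, b') \<in> P" for b b'
    using that assms(3) by (auto simp: P_def dir_edges_def)
  have disj: "V e \<inter> V e' = {}" if "e \<in> P" "e' \<in> P" "e \<noteq> e'" for e e'
  proof -
    obtain b b' c c' where e: "e = (b, b')" "e' = (c, c')" by (metis surj_pair)
    have "b(i := u) \<noteq> c(i := v) \<or> b'(i := u) \<noteq> c'(i := v)" for u v
      using that one[of b b'] one[of c c'] unfolding e by (metis fun_upd_triv fun_upd_upd)
    then show ?thesis by (auto simp: V_def e)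
  qed
  have cV: "card (V (b, b')) = card (line_set n i F b - line_set n i F b')" for b b'
    unfolding V_def prod.case by (intro card_image inj_onI) (auto dest!: fun_cong[where x=i])
  have "dir_violations n d j F = (\<Union>e\<in>P. V e)"
  proof (intro equalityI subsetI)
    fix e assume "e \<in> dir_violations n d j F"
    then obtain x y a where e: "e = (x, y)" "x \<in> grid n d" "y \<in> grid n d" "y = x(j := x j + 2 ^ a)"
        "x \<in> F" "y \<notin> F"
      unfolding dir_violations_def dir_edges_def by blast
    have yi: "y i = x i" using e(4) assms(3) by simp
    have r: "1 \<le> x i" "x i \<le> n" using grid_range[OF e(2) assms(2)] by auto
    have "y(i := 1) = (x(i := 1))(j := (x(i := 1)) j + 2 ^ a)" using e(4) assms(3) by (simp add: fun_upd_twist)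
    then have "(x(i := 1), y(i := 1)) \<in> P"
      using e r assms by (auto simp: P_def dir_edges_def grid_upd)
    moreover have "x i - 1 \<in> line_set n i F (x(i := 1)) - line_set n i F (y(i := 1))"
      using r e(5,6) yi by (auto simp: line_set_def) (metis fun_upd_triv)
    moreover have "e = ((x(i := 1))(i := Suc (x i - 1)), (y(i := 1))(i := Suc (x i - 1)))"
      using r yi e(1) by auto
    ultimately have "e \<in> V (x(i := 1), y(i := 1))" unfolding V_def prod.case by (intro image_eqI)
    then show "e \<in> (\<Union>e\<in>P. V e)" using \<open>(x(i := 1), y(i := 1)) \<in> P\<close> by blast
  next
    fix e assume "e \<in> (\<Union>e\<in>P. V e)"
    then obtain b b' v where *: "(b, b') \<in> P" "v \<in> line_set n i F b" "v \<notin> line_set n i F b'"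
        "e = (b(i := Suc v), b'(i := Suc v))"
      by (auto simp: V_def)
    then obtain a where a: "b \<in> grid n d" "b' \<in> grid n d" "b' = b(j := b j + 2 ^ a)"
      by (auto simp: P_def dir_edges_def)
    have "v < n" using * by (simp add: line_set_def)
    moreover have "b j + 2 ^ a \<in> {1..n}" using grid_range[OF a(2) assms(1)] a(3) by simp
    moreover have "b'(i := Suc v) = (b(i := Suc v))(j := (b(i := Suc v)) j + 2 ^ a)"
      using a(3) assms(3) by (simp add: fun_upd_twist)
    moreover have "b(i := Suc v) \<in> F" "b'(i := Suc v) \<notin> F"
      using * by (auto simp: line_set_def)
    ultimately show "e \<in> dir_violations n d j F"
      using a(1,2) assms * by (auto simp: dir_violations_def dir_edges_def grid_upd)
  qed
  then have "card (dir_violations n d j F) = (\<Sum>e\<in>P. card (V e))"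
    using finP disj by (simp add: card_UN_disjoint V_def line_set_def split: prod.splits)
  also have "\<dots> = (\<Sum>(b, b')\<in>P. card (line_set n i F b - line_set n i F b'))"
    by (intro sum.cong) (auto simp: cV)
  finally show ?thesis by (simp add: P_def)
qed

text \<open>After sorting, the sets on the two lines are final segments of unchanged sizes. They are
  nested, so their difference is the smallest that these sizes allow.\<close>

lemma card_dir_violations_sort_dir:
  assumes "j < d" "i < d" "i \<noteq> j"
  shows "card (dir_violations n d j (sort_dir n d i F)) \<le> card (dir_violations n d j F)"
  unfolding card_dir_violations[OF assms]
proof (intro sum_mono, clarify)
  fix b b' assume "(b, b') \<in> dir_edges n d j"
  then have g: "b \<in> grid n d" "b' \<in> grid n d" by (auto simp: dir_edges_def)
  let ?k = "card (line_set n i F b)" and ?k' = "card (line_set n i F b')"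
  have "{n - ?k..<n} - {n - ?k'..<n} = {n - ?k..<n - ?k'}" by auto
  then have "card ({n - ?k..<n} - {n - ?k'..<n}) = ?k - ?k'"
    using card_line_set[of n i F b] card_line_set[of n i F b'] by simp
  also have "\<dots> \<le> card (line_set n i F b - line_set n i F b')"
    by (rule diff_card_le_card_Diff) (simp add: line_set_def)
  finally show "card (line_set n i (sort_dir n d i F) b - line_set n i (sort_dir n d i F) b')
      \<le> card (line_set n i F b - line_set n i F b')"
    using line_set_sort_dir[OF _ assms(2)] g by simp
qed

lemma dir_violations_sort_dir_self:
  assumes "i < d"
  shows "dir_violations n d i (sort_dir n d i F) = {}"
  by (auto simp: dir_violations_def dir_edges_def sort_dir_def)

lemma transport_card: "transport E A B m \<Longrightarrow> card A = card B"
  unfolding transport_def using bij_betw_same_card by blast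

text \<open>The invariant compares every direction with \<open>F\<close>: directions already sorted
  stay free of violations, and sorting direction \<open>k\<close> is charged to the violations of
  \<open>F\<close> instead of those of the current set.\<close>

lemma exists_sorted:
  assumes "F \<subseteq> grid n d"
  shows "k \<le> d \<Longrightarrow> \<exists>G \<subseteq> grid n d. (\<forall>j<k. dir_violations n d j G = {}) \<and>
     (\<forall>j<d. card (dir_violations n d j G) \<le> card (dir_violations n d j F)) \<and>
     transport (aug_edges n d) F G (2 * (\<Sum>i<k. card (dir_violations n d i F)))"
proof (induction k)
  case 0
  then show ?case using assms transport_refl by (intro exI[of _ F]) simp
next
  case (Suc k)
  then obtain G where G: "G \<subseteq> grid n d" "\<forall>j<k. dir_violations n d j G = {}"
      "\<forall>j<d. card (dir_violations n d j G) \<le> card (dir_violations n d j F)"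
      "transport (aug_edges n d) F G (2 * (\<Sum>i<k. card (dir_violations n d i F)))"
    by auto
  define H where "H = sort_dir n d k G"
  have kd: "k < d" using Suc.prems by simp
  have le: "card (dir_violations n d j H) \<le> card (dir_violations n d j G)" if "j < d" for j
    using card_dir_violations_sort_dir[OF that kd] dir_violations_sort_dir_self[OF kd, of n G]
    by (cases "j = k") (auto simp: H_def)
  have "dir_violations n d j H = {}" if "j < Suc k" for j
  proof (cases "j = k")
    case False
    then have "card (dir_violations n d j H) = 0" using le[of j] G(2) that kd by auto
    then show ?thesis using finite_dir_violations by auto
  qed (use dir_violations_sort_dir_self[OF kd] in \<open>simp add: H_def\<close>)
  moreover have "H \<subseteq> grid n d" by (auto simp: H_def sort_dir_def)
  moreover have "transport (aug_edges n d) F H (2 * (\<Sum>i<Suc k. card (dir_violations n d i F)))"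
    by (rule transport_mono[OF transport_trans[OF G(4) transport_sort_dir[OF G(1) kd, folded H_def]]])
      (use G(3) kd in simp)
  ultimately show ?case using le G(3) by (intro exI[of _ H]) (meson order_trans)
qed

text \<open>Unit steps are edges with \<open>a = 0\<close>, and a chain of them leads from
  \<open>x\<close> up to \<open>y\<close> inside the grid.\<close>

lemma up_closed_if_no_violations:
  assumes nov: "\<forall>j<d. dir_violations n d j G = {}" and x: "x \<in> G" "x \<in> grid n d"
    and y: "y \<in> grid n d" "x \<le> y"
  shows "y \<in> G"
  using x y(2)
proof (induction "\<Sum>i<d. y i - x i" arbitrary: x rule: less_induct)
  case less
  show ?case
  proof (cases "x = y")
    case False
    then obtain i where "x i \<noteq> y i" by blast
    moreover from this have "i < d"
      using less.prems(2) y(1) by (metis PiE_arb grid_def lessThan_iff)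
    ultimately have i: "x i < y i" "i < d" using less.prems(3) by (auto simp: le_fun_def order_less_le)
    define z where "z = x(i := Suc (x i))"
    have z: "z \<in> grid n d"
      using i grid_range[OF y(1) i(2)] less.prems(2) by (auto simp: z_def grid_upd)
    have "(x, z) \<in> dir_edges n d i"
      using z less.prems(2) by (auto simp: dir_edges_def z_def intro!: exI[of _ 0])
    then have "z \<in> G" using nov less.prems(1) i(2) by (auto simp: dir_violations_def)
    moreover have "z \<le> y" using less.prems(3) i by (auto simp: z_def le_fun_def)
    moreover have "(\<Sum>i<d. y i - z i) < (\<Sum>i<d. y i - x i)"
      using i by (intro sum_strict_mono_ex1) (auto simp: z_def)
    ultimately show ?thesis using less.hyps z by blast
  qed (use less.prems in simp)
qed

lemma card_violated_edges:
  assumes "F = {x \<in> grid n d. f x = 1}" and "f \<in> grid n d \<rightarrow> {0, 1}"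
  shows "card (violated_edges n d f) = (\<Sum>i<d. card (dir_violations n d i F))"
proof -
  have "dir_violations n d i F = {(x, y) \<in> dir_edges n d i. f x = 1 \<and> f y = 0}" for i
    using assms by (auto simp: dir_violations_def dir_edges_def Pi_def)
  then have "violated_edges n d f = (\<Union>i<d. dir_violations n d i F)"
    unfolding violated_edges_def aug_edges_eq by auto
  moreover have "dir_violations n d i F \<inter> dir_violations n d j F = {}" if "i \<noteq> j" for i j
  proof -
    have "x(i := x i + 2 ^ a) \<noteq> x(j := x j + 2 ^ b)" for x :: "nat \<Rightarrow> nat" and a b
      using that by (auto dest!: fun_cong[where x=i])
    then show ?thesis by (auto simp: dir_violations_def dir_edges_def)
  qed
  ultimately show ?thesis by (simp add: card_UN_disjoint finite_dir_violations)
qed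

lemma transport_to_monotone:
  assumes "F = {x \<in> grid n d. f x = 1}" and "f \<in> grid n d \<rightarrow> {0, 1}"
  obtains G where "G \<subseteq> grid n d" "\<And>x y. x \<in> G \<Longrightarrow> y \<in> grid n d \<Longrightarrow> x \<le> y \<Longrightarrow> y \<in> G"
    "transport (aug_edges n d) F G (2 * card (violated_edges n d f))"
proof -
  have "F \<subseteq> grid n d" using assms by auto
  from exists_sorted[OF this, of d] obtain G where G: "G \<subseteq> grid n d" "\<forall>j<d. dir_violations n d j G = {}"
      "transport (aug_edges n d) F G (2 * card (violated_edges n d f))"
    using card_violated_edges[OF assms] by auto
  then show ?thesis using that up_closed_if_no_violations[OF G(2)] by blast
qed

section \<open>The isoperimetric inequality\<close>

text \<open>The two steps are made in the opposite order. Truncated subtraction is exact on paths,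
  where \<open>v \<le> w\<close>.\<close>

definition flip_middle :: "(nat \<Rightarrow> nat) \<Rightarrow> (nat \<Rightarrow> nat) \<Rightarrow> (nat \<Rightarrow> nat) \<Rightarrow> nat \<Rightarrow> nat" where
  "flip_middle u v w i = u i + w i - v i"

lemma lazy_edge_iff:
  "(x, y) \<in> aug_edges n d \<union> Id_on (grid n d) \<longleftrightarrow> x \<in> grid n d \<and> y \<in> grid n d \<and>
     (y = x \<or> (\<exists>i<d. \<exists>a. y = x(i := x i + 2 ^ a)))"
  unfolding aug_edges_eq dir_edges_def by blast

lemma lazy_edge_le: "(x, y) \<in> aug_edges n d \<union> Id_on (grid n d) \<Longrightarrow> x \<le> y"
  unfolding lazy_edge_iff by (auto simp: le_fun_def)

lemma grid_between:
  assumes "x \<in> grid n d" "y \<in> grid n d" "x \<le> z" "z \<le> y"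
  shows "z \<in> grid n d"
proof -
  have b: "x i \<le> z i \<and> z i \<le> y i" for i using assms(3,4) by (simp add: le_fun_def)
  show ?thesis unfolding grid_def
  proof (rule PiE_I)
    fix i assume "i \<in> {..<d}"
    then show "z i \<in> {1..n}"
      using b[of i] grid_range[OF assms(1), of i] grid_range[OF assms(2), of i] by auto
  next
    fix i assume "i \<notin> {..<d}"
    then show "z i = undefined"
      using b[of i] assms(1,2) unfolding grid_def by (metis PiE_arb order_antisym)
  qed
qed

text \<open>The new middle vertex is \<open>u\<close> moved by the step from \<open>v\<close> to
  \<open>w\<close>. It lies coordinatewise between \<open>u\<close> and \<open>w\<close>, and a box
  contains everything between two of its points.\<close>

lemma lazy_flip:
  assumes uv: "(u, v) \<in> aug_edges n d \<union> Id_on (grid n d)" and vw: "(v, w) \<in> aug_edges n d \<union> Id_on (grid n d)"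
  shows "(u, flip_middle u v w) \<in> aug_edges n d \<union> Id_on (grid n d) \<and>
    (flip_middle u v w, w) \<in> aug_edges n d \<union> Id_on (grid n d)"
proof -
  let ?c = "flip_middle u v w"
  have g: "u \<in> grid n d" "w \<in> grid n d" using uv vw unfolding lazy_edge_iff by auto
  have le: "u i \<le> v i" "v i \<le> w i" for i
    using lazy_edge_le[OF uv] lazy_edge_le[OF vw] by (auto simp: le_fun_def)
  have "u i \<le> ?c i \<and> ?c i \<le> w i" for i
    using le[of i] unfolding flip_middle_def by linarith
  then have "u \<le> ?c" "?c \<le> w" by (simp_all add: le_fun_def)
  then have c: "?c \<in> grid n d" using grid_between g by blast
  have "?c = u \<or> (\<exists>i<d. \<exists>a. ?c = u(i := u i + 2 ^ a))"
  proof (cases "w = v")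
    case True
    then have "?c = u" by (auto simp: flip_middle_def)
    then show ?thesis ..
  next
    case False
    then obtain i a where i: "i < d" "w = v(i := v i + 2 ^ a)" using vw unfolding lazy_edge_iff by blast
    then have "?c = u(i := u i + 2 ^ a)" by (auto simp: flip_middle_def)
    then show ?thesis using i(1) by blast
  qed
  moreover have "w = ?c \<or> (\<exists>i<d. \<exists>a. w = ?c(i := ?c i + 2 ^ a))"
  proof (cases "v = u")
    case True
    then have "?c = w" by (auto simp: flip_middle_def)
    then show ?thesis by simp
  next
    case False
    then obtain i a where i: "i < d" "v = u(i := u i + 2 ^ a)" using uv unfolding lazy_edge_iff by blast
    have "w = ?c(i := ?c i + 2 ^ a)"
    proof
      fix j show "w j = (?c(i := ?c i + 2 ^ a)) j"
        using i(2) le(2)[of j] by (auto simp: flip_middle_def)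
    qed
    then show ?thesis using i(1) by blast
  qed
  ultimately show ?thesis using g c unfolding lazy_edge_iff by blast
qed

lemma commutative_graph_aug_edges:
  "commutative_graph (aug_edges n d \<union> Id_on (grid n d)) flip_middle"
proof -
  let ?E = "aug_edges n d \<union> Id_on (grid n d)"
  have add: "flip_middle u v w i + v i = u i + w i" if "(v, w) \<in> ?E" for u v w i
    using lazy_edge_le[OF that] by (simp add: flip_middle_def le_fun_def trans_le_add2)
  show ?thesis
  proof (unfold_locales, goal_cases)
    case 1
    show ?case by (rule finite_subset[of _ "grid n d \<times> grid n d"]) (auto simp: aug_edges_def finite_grid)
  next
    case (2 u v w)
    then show ?case by (rule lazy_flip)
  next
    case (3 u v w w')
    show ?case
    proof
      fix i show "w i = w' i" using add[OF 3(2), of u i] add[OF 3(3), of u i] 3(4) by simp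
    qed
  next
    case (4 u v u' w)
    show ?case
    proof
      fix i show "u i = u' i" using add[OF 4(3), of u i] add[OF 4(3), of u' i] 4(4) by simp
    qed
  qed
qed

lemma relpow_in_grid:
  assumes "(x, y) \<in> aug_edges n d ^^ k" "x \<in> grid n d"
  shows "y \<in> grid n d"
proof (cases k)
  case (Suc m)
  then obtain z where "(z, y) \<in> aug_edges n d" using assms(1) by auto
  then show ?thesis by (simp add: aug_edges_def)
qed (use assms in simp)

text \<open>Loops at the end point stretch the path to exactly \<open>R\<close> steps.\<close>

lemma lazy_path:
  assumes "(x, y) \<in> aug_edges n d ^^ k" "x \<in> grid n d" "k \<le> R"
  shows "\<exists>p. p 0 = x \<and> p R = y \<and> (\<forall>i<R. (p i, p (Suc i)) \<in> aug_edges n d \<union> Id_on (grid n d))"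
proof -
  obtain q where q: "q 0 = x" "q k = y" "\<forall>i<k. (q i, q (Suc i)) \<in> aug_edges n d"
    using assms(1) unfolding relpow_fun_conv by blast
  have y: "y \<in> grid n d" using relpow_in_grid assms(1,2) by blast
  show ?thesis
  proof (intro exI[of _ "\<lambda>i. q (min i k)"] conjI allI impI)
    fix i assume "i < R"
    show "(q (min i k), q (min (Suc i) k)) \<in> aug_edges n d \<union> Id_on (grid n d)"
      using q(3) y q(2) by (cases "i < k") (auto simp: min_def)
  qed (use q assms(3) in \<open>auto simp: min_def\<close>)
qed

section \<open>From a maximum matching to a cut, and the choice of the number of layers\<close>

definition vertex_cover :: "('a \<times> 'a) set \<Rightarrow> 'a set \<Rightarrow> bool" where
  "vertex_cover E C \<longleftrightarrow> (\<forall>(x, y)\<in>E. x \<in> C \<or> y \<in> C)"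

lemma is_matching_insert:
  assumes "is_matching M" "x \<notin> fst ` M \<union> snd ` M" "y \<notin> fst ` M \<union> snd ` M"
  shows "is_matching (insert (x, y) M)"
proof -
  have "{x, y} \<inter> {fst e, snd e} = {}" "{fst e, snd e} \<inter> {x, y} = {}" if "e \<in> M" for e
    using assms(2,3) that by (auto simp: image_iff)
  then show ?thesis using assms(1) unfolding is_matching_def by (simp; metis)
qed

lemma vertex_cover_from_matching:
  obtains C where "finite C" "vertex_cover (violated_edges n d f) C"
    "card C \<le> 2 * Max {card M |M. M \<subseteq> violated_edges n d f \<and> is_matching M}"
proof -
  let ?\<nu> = "Max {card M |M. M \<subseteq> violated_edges n d f \<and> is_matching M}"
  let ?S = "{card M |M. M \<subseteq> violated_edges n d f \<and> is_matching M}"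
  have "?\<nu> \<in> ?S" using Max_in[OF matching_sizes] .
  then obtain M where M: "M \<subseteq> violated_edges n d f" "is_matching M" "card M = ?\<nu>" by auto
  have finM: "finite M" using M(1) finite_violated_edges finite_subset by blast
  define C where "C = fst ` M \<union> snd ` M"
  have "card C \<le> card (fst ` M) + card (snd ` M)" unfolding C_def by (rule card_Un_le)
  then have "card C \<le> 2 * ?\<nu>"
    using card_image_le[OF finM, of fst] card_image_le[OF finM, of snd] M(3) by simp
  moreover have "vertex_cover (violated_edges n d f) C"
    unfolding vertex_cover_def
  proof (intro ballI, clarify, rule ccontr)
    fix x y assume xy: "(x, y) \<in> violated_edges n d f" "y \<notin> C"
    assume xC: "x \<notin> C"
    have "is_matching (insert (x, y) M)"
      using M(2) xy(2) xC by (intro is_matching_insert) (auto simp: C_def)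
    then have "card (insert (x, y) M) \<in> ?S" using M(1) xy(1) by blast
    then have "card (insert (x, y) M) \<le> ?\<nu>" by (rule Max_ge[OF matching_sizes(1)])
    moreover have "(x, y) \<notin> M" using xC by (force simp: C_def)
    ultimately show False using finM M(3) by simp
  qed
  moreover have "finite C" using finM by (simp add: C_def)
  ultimately show ?thesis using that by blast
qed

lemma card_violated_ge_matching:
  "Max {card M |M. M \<subseteq> violated_edges n d f \<and> is_matching M} \<le> card (violated_edges n d f)"
  using matching_sizes by (auto intro!: Max.boundedI card_mono simp: finite_violated_edges)

text \<open>
  Sources whose path is longer than \<open>R\<close> are few; the remaining ones are separated from their targets by
  \<open>R + 1\<close> copies of the cover together with the targets in which \<open>f\<close> is already one.
\<close>

lemma card_moved_le:
  assumes F: "F = {x \<in> grid n d. f x = 1}" and f01: "f \<in> grid n d \<rightarrow> {0, 1}"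
    and G: "G \<subseteq> grid n d" and tr: "transport (aug_edges n d) F G m"
    and C: "finite C" "vertex_cover (violated_edges n d f) C"
  shows "card (F - G) * Suc R \<le> (Suc R * card C) * Suc R + m"
proof -
  interpret commutative_graph "aug_edges n d \<union> Id_on (grid n d)" flip_middle
    by (rule commutative_graph_aug_edges)
  obtain \<pi> len where \<pi>: "bij_betw \<pi> F G" "\<forall>x\<in>F. (x, \<pi> x) \<in> aug_edges n d ^^ len x" "sum len F \<le> m"
    using tr unfolding transport_def by blast
  have finF: "finite F" using F finite_grid by simp
  define S where "S = {x \<in> F. len x \<le> R}"
  \<comment> \<open>The targets in \<open>F \<inter> G\<close> have to be blocked because a path
    between points of \<open>F\<close> may never leave \<open>F\<close>. Their number cancels later
    against the same summand of \<open>card F\<close>.\<close>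
  define K where "K = {..R} \<times> C \<union> {R} \<times> (F \<inter> G)"
  have finK: "finite K" using C(1) finF by (simp add: K_def)
  have inj: "inj_on \<pi> S" using \<pi>(1) by (auto simp: bij_betw_def S_def intro: inj_on_subset)
  have "layered_cut R S (\<pi> ` S) K"
    unfolding layered_cut_def
  proof (intro allI impI)
    fix p assume p: "p 0 \<in> S" "p R \<in> \<pi> ` S" "path_on 0 R p"
    have TG: "p R \<in> G" using p(2) \<pi>(1) by (auto simp: S_def bij_betw_def)
    show "\<exists>i\<le>R. (i, p i) \<in> K"
    proof (cases "p R \<in> F")
      case True
      then show ?thesis using TG by (intro exI[of _ R]) (simp add: K_def)
    next
      case False
      \<comment> \<open>The first step out of \<open>F\<close> is not a loop, so it is a violated
        edge, and the cover blocks one of its end points at the time of the visit.\<close>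
      define i where "i = (LEAST i. p i \<notin> F)"
      have i: "p i \<notin> F" "i \<le> R" using LeastI[of "\<lambda>i. p i \<notin> F"] Least_le[of "\<lambda>i. p i \<notin> F"] False
        by (auto simp: i_def)
      have "i \<noteq> 0" using i(1) p(1) by (cases i) (auto simp: S_def)
      then obtain j where j: "i = Suc j" using not0_implies_Suc by blast
      have jF: "p j \<in> F" using not_less_Least[of j "\<lambda>i. p i \<notin> F"] j by (simp add: i_def)
      have "(p j, p i) \<in> aug_edges n d \<union> Id_on (grid n d)"
        using p(3) i(2) j by (auto simp: path_on_def)
      then have "(p j, p i) \<in> aug_edges n d" using jF i(1) by auto
      moreover from this have "p i \<in> grid n d" by (simp add: aug_edges_def)
      ultimately have "(p j, p i) \<in> violated_edges n d f"
        using jF i(1) f01 F by (auto simp: violated_edges_def)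
      then have "p j \<in> C \<or> p i \<in> C" using C(2) by (auto simp: vertex_cover_def)
      then show ?thesis
      proof
        assume "p j \<in> C"
        then show ?thesis using i(2) j by (intro exI[of _ j]) (simp add: K_def)
      next
        assume "p i \<in> C"
        then show ?thesis using i(2) by (intro exI[of _ i]) (simp add: K_def)
      qed
    qed
  qed
  moreover have "\<exists>p. p 0 = x \<and> p R = \<pi> x \<and> path_on 0 R p" if "x \<in> S" for x
    using lazy_path[where x=x and y="\<pi> x" and n=n and d=d and k="len x" and R=R] \<pi>(2) that F
    by (auto simp: S_def path_on_def)
  ultimately have "card S \<le> card K" using card_sources_le_cut[OF inj] finK by blast
  also have "\<dots> \<le> card ({..R} \<times> C) + card ({R} \<times> (F \<inter> G))" unfolding K_def by (rule card_Un_le)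
  finally have cS: "card S \<le> Suc R * card C + card (F \<inter> G)" by (simp add: card_cartesian_product)
  have "card (F - S) * Suc R = (\<Sum>x\<in>F - S. Suc R)" by simp
  also have "\<dots> \<le> sum len (F - S)" by (intro sum_mono) (auto simp: S_def)
  also have "\<dots> \<le> sum len F" using finF by (intro sum_mono2) auto
  finally have far: "card (F - S) * Suc R \<le> m" using \<pi>(3) by simp
  have "card F = card S + card (F - S)"
    using finF by (subst card_Un_disjoint[symmetric]) (auto simp: S_def intro!: arg_cong[where f=card])
  moreover have "card F = card (F - G) + card (F \<inter> G)"
    using finF card_Int_Diff[of F G] by simp
  ultimately have "card (F - G) \<le> Suc R * card C + card (F - S)" using cS by linarith
  then have "card (F - G) * Suc R \<le> (Suc R * card C + card (F - S)) * Suc R" by (rule mult_le_mono1)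
  then show ?thesis using far by (simp add: distrib_right)
qed

text \<open>For \<open>R = 4 * N div t\<close> the term \<open>2 * N\<close> is less than half of
  \<open>t * Suc R\<close>, which leaves \<open>t \<le> 4 * \<nu> * Suc R\<close>. The bound at
  \<open>R = 0\<close> gives \<open>t \<le> 4 * N\<close>, hence
  \<open>t * Suc R \<le> 8 * N\<close>. The product of the two factors \<open>4\<close> and
  \<open>8\<close> is the constant.\<close>

lemma square_bound:
  fixes t \<nu> N :: nat
  assumes bound: "\<And>R. t * Suc R \<le> (Suc R * (2 * \<nu>)) * Suc R + 2 * N" and "\<nu> \<le> N"
  shows "t\<^sup>2 \<le> 32 * (N * \<nu>)"
proof (cases "t = 0")
  case False
  define R where "R = 4 * N div t"
  have "t \<le> 4 * N" using bound[of 0] assms(2) by simp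
  have lt: "4 * N < t * Suc R" using False by (simp add: R_def dividend_less_times_div)
  have "t * Suc R \<le> 2 * (Suc R * (2 * \<nu>) * Suc R)" using bound[of R] lt by linarith
  then have "t * Suc R \<le> 4 * \<nu> * Suc R * Suc R" by (simp add: algebra_simps)
  then have 1: "t \<le> 4 * \<nu> * Suc R" by (metis Suc_not_Zero mult_le_cancel2 zero_less_Suc)
  have "t * R \<le> 4 * N" by (simp add: R_def)
  then have 2: "t * Suc R \<le> 8 * N" using \<open>t \<le> 4 * N\<close> by simp
  have "t\<^sup>2 \<le> t * (4 * \<nu> * Suc R)" unfolding power2_eq_square using 1 by (rule mult_le_mono2)
  also have "\<dots> = 4 * \<nu> * (t * Suc R)" by (simp only: ac_simps)
  also have "\<dots> \<le> 4 * \<nu> * (8 * N)" using 2 by (rule mult_le_mono2)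
  finally show ?thesis by (simp add: ac_simps)
qed simp

text \<open>The indicator of \<open>G\<close> is a monotone competitor for \<open>f\<close>. Equal
  sizes make \<open>F - G\<close> and \<open>G - F\<close> equally large, whence the factor
  \<open>2\<close>.\<close>

lemma farness_le_moved:
  assumes F: "F = {x \<in> grid n d. f x = 1}" and f01: "f \<in> grid n d \<rightarrow> {0, 1}"
    and far: "far_from_monotone n d \<epsilon> f"
    and G: "G \<subseteq> grid n d" "\<And>x y. x \<in> G \<Longrightarrow> y \<in> grid n d \<Longrightarrow> x \<le> y \<Longrightarrow> y \<in> G"
    and eq: "card F = card G"
  shows "\<epsilon> * real (n ^ d) \<le> 2 * real (card (F - G))"
proof -
  define g :: "(nat \<Rightarrow> nat) \<Rightarrow> nat" where "g x = (if x \<in> G then 1 else 0)" for x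
  have fin: "finite F" "finite G" using F G(1) finite_grid finite_subset[OF _ finite_grid] by auto
  have "mono_on (grid n d) g" using G(2) by (auto simp: mono_on_def g_def)
  moreover have "g \<in> grid n d \<rightarrow> {0, 1}" by (auto simp: g_def)
  ultimately have "\<epsilon> * real (n ^ d) \<le> real (card {x \<in> grid n d. f x \<noteq> g x})"
    using far unfolding far_from_monotone_def by blast
  also have "{x \<in> grid n d. f x \<noteq> g x} \<subseteq> (F - G) \<union> (G - F)"
    using f01 F by (auto simp: g_def Pi_iff)
  then have "card {x \<in> grid n d. f x \<noteq> g x} \<le> card ((F - G) \<union> (G - F))"
    using fin by (intro card_mono) auto
  also have "card ((F - G) \<union> (G - F)) \<le> card (F - G) + card (G - F)" by (rule card_Un_le)
  also have "card (G - F) = card (F - G)"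
    using eq fin card_Int_Diff[of F G] card_Int_Diff[of G F] by (simp add: Int_commute)
  finally show ?thesis by simp
qed

theorem theorem2p1:
  "\<exists>c::real. c > 0 \<and>
     (\<forall>(n::nat) (d::nat) (\<epsilon>::real) (f :: (nat \<Rightarrow> nat) \<Rightarrow> nat).
        (\<exists>k::nat. n = 2 ^ k) \<longrightarrow> \<epsilon> > 0 \<longrightarrow>
        f \<in> grid n d \<rightarrow> {0, 1} \<longrightarrow> far_from_monotone n d \<epsilon> f \<longrightarrow>
        neg_influence n d f * neg_matching n d f \<ge> c * \<epsilon>\<^sup>2)"
proof (intro exI[of _ "1 / 128"] conjI allI impI)
  fix n d :: nat and \<epsilon> :: real and f :: "(nat \<Rightarrow> nat) \<Rightarrow> nat"
  assume n: "\<exists>k. n = 2 ^ k" and eps: "\<epsilon> > 0" and f01: "f \<in> grid n d \<rightarrow> {0, 1}"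
    and far: "far_from_monotone n d \<epsilon> f"
  define N where "N = card (violated_edges n d f)"
  define \<nu> where "\<nu> = Max {card M |M. M \<subseteq> violated_edges n d f \<and> is_matching M}"
  define F where "F = {x \<in> grid n d. f x = 1}"
  obtain G where G: "G \<subseteq> grid n d" "\<And>x y. x \<in> G \<Longrightarrow> y \<in> grid n d \<Longrightarrow> x \<le> y \<Longrightarrow> y \<in> G"
      "transport (aug_edges n d) F G (2 * N)"
    unfolding N_def using transport_to_monotone[OF F_def f01] by blast
  obtain C where C: "finite C" "vertex_cover (violated_edges n d f) C" "card C \<le> 2 * \<nu>"
    unfolding \<nu>_def by (rule vertex_cover_from_matching)
  define t where "t = card (F - G)"
  have "t * Suc R \<le> (Suc R * (2 * \<nu>)) * Suc R + 2 * N" for R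
  proof -
    have "t * Suc R \<le> (Suc R * card C) * Suc R + 2 * N"
      unfolding t_def by (rule card_moved_le[OF F_def f01 G(1,3) C(1,2)])
    also have "\<dots> \<le> (Suc R * (2 * \<nu>)) * Suc R + 2 * N"
      using C(3) by (intro add_mono mult_le_mono) auto
    finally show ?thesis .
  qed
  then have "t\<^sup>2 \<le> 32 * (N * \<nu>)"
    using card_violated_ge_matching[of n d f] by (intro square_bound) (simp_all add: N_def \<nu>_def)
  then have "(real t)\<^sup>2 \<le> 32 * (real N * real \<nu>)"
    by (metis of_nat_le_iff of_nat_mult of_nat_numeral of_nat_power)
  moreover have "\<epsilon> * real (n ^ d) \<le> 2 * real t"
    unfolding t_def using transport_card[OF G(3)] by (intro farness_le_moved[OF F_def f01 far G(1,2)])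
  then have "(\<epsilon> * real (n ^ d))\<^sup>2 \<le> (2 * real t)\<^sup>2" using eps by (intro power_mono) auto
  \<comment> \<open>\<open>128 = 4 * 32\<close>: the square of the factor \<open>2\<close> in
    \<open>farness_le_moved\<close> times the constant of \<open>square_bound\<close>.\<close>
  ultimately have "\<epsilon>\<^sup>2 * (real (n ^ d))\<^sup>2 \<le> 128 * (real N * real \<nu>)"
    by (simp add: power_mult_distrib)
  moreover have "real (n ^ d) > 0" using n by auto
  ultimately show "1 / 128 * \<epsilon>\<^sup>2 \<le> neg_influence n d f * neg_matching n d f"
    unfolding neg_influence_def neg_matching_def N_def[symmetric] \<nu>_def[symmetric]
    by (simp add: field_simps power2_eq_square)
qed simp

end
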